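(* Let $G=(V,E)$ be a graph on $n$ vertices and let $w:V\to\mathbb{R}_{\geq 0}$. Let $\lambda^1\geq\lambda^2\geq\cdots\geq\lambda^n$ be the eigenvalues of $L^w(G)$. Then, for all $k\geq 0$, \[ \dim\big(\tilde H_k(I(G);\mathbb{R})\big)\leq\Big|\Big\{I\subseteq[n],\ |I|=k+1 :\ \sum_{i\in I}\lambda^{i}\geq\sum_{v\in V}w(v)\Big\}\Big|. \]
   Context: The vertex-weighted Laplacian $L^w(G)\in\mathbb{R}^{V\times V}$ is defined by $L^w(G)_{u,u}=\sum_{u'\in N_G(u)}w(u')$, $L^w(G)_{u,v}=-w(v)$ if $\{u,v\}\in E$, and $0$ otherwise; its eigenvalues are real. The independence complex $I(G)$ is the simplicial complex on $V$ whose simplices are the independent sets of $G$; $\tilde H_k(\cdot;\mathbb{R})$ denotes reduced simplicial homology with real coefficients. *)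

theory Defs
  imports
    "HOL-Combinatorics.Permutations"
    "Jordan_Normal_Form.Char_Poly"
    "Jordan_Normal_Form.VS_Connect"
    "HOL-Algebra.AbelCoset"
begin

hide_const (open) Multiset.mult Polynomial.smult

section \<open>Graphs and the vertex-weighted Laplacian\<close>

definition simple_graph :: "'a set \<Rightarrow> 'a set set \<Rightarrow> bool" where
  "simple_graph V E \<longleftrightarrow> finite V \<and> (\<forall>e\<in>E. e \<subseteq> V \<and> card e = 2)"

definition neighbours :: "'a set set \<Rightarrow> 'a \<Rightarrow> 'a set" where
  "neighbours E u = {v. {u, v} \<in> E}"

definition weighted_laplacian :: "'a set set \<Rightarrow> ('a \<Rightarrow> real) \<Rightarrow> 'a \<Rightarrow> 'a \<Rightarrow> real" where
  "weighted_laplacian E w u v =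
     (if u = v then \<Sum>u'\<in>neighbours E u. w u'
      else if {u, v} \<in> E then - w v
      else 0)"

text \<open>The matrix of a real array indexed by the entries of the duplicate-free list \<open>vs\<close>.
  Listing the same entries in another order conjugates this matrix by a permutation matrix, so its
  characteristic polynomial does not depend on the order.\<close>

definition matrix_wrt :: "'a list \<Rightarrow> ('a \<Rightarrow> 'a \<Rightarrow> real) \<Rightarrow> real mat" where
  "matrix_wrt vs L = mat (length vs) (length vs) (\<lambda>(i, j). L (vs ! i) (vs ! j))"

text \<open>\<open>l 1 \<ge> \<dots> \<ge> l n\<close> is the list of all eigenvalues of the \<open>n \<times> n\<close> matrix \<open>A\<close>, repeated
  according to their algebraic multiplicity. The values of \<open>l\<close> outside \<open>{1..n}\<close> are irrelevant.\<close>

definition ordered_eigenvalues :: "real mat \<Rightarrow> (nat \<Rightarrow> real) \<Rightarrow> bool" where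
  "ordered_eigenvalues A l \<longleftrightarrow>
     char_poly A = (\<Prod>i=1..dim_row A. [:- l i, 1:]) \<and>
     (\<forall>i j. 1 \<le> i \<and> i \<le> j \<and> j \<le> dim_row A \<longrightarrow> l j \<le> l i)"

section \<open>The independence complex\<close>

text \<open>A simplicial complex is given by its set of simplices, which includes the empty simplex.\<close>

definition independence_complex :: "'a set \<Rightarrow> 'a set set \<Rightarrow> 'a set set" where
  "independence_complex V E = {S. S \<subseteq> V \<and> (\<forall>u\<in>S. \<forall>v\<in>S. {u, v} \<notin> E)}"

section \<open>Reduced simplicial homology with real coefficients\<close>

text \<open>Oriented chains: \<open>oriented_chains X m\<close> is the space \<open>C\<^bsub>m-1\<^esub>(X; \<real>)\<close> of chains on the
  simplices with \<open>m\<close> vertices. An ordering \<open>[x\<^sub>1, \<dots>, x\<^sub>m]\<close> of the vertices of a simplex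
  is an oriented simplex, and a chain is a real function on the oriented simplices which is
  multiplied by the sign of the permutation when the vertices are reordered. So the value
  \<open>c [x\<^sub>1, \<dots>, x\<^sub>m]\<close> is the coefficient of that oriented simplex in \<open>c\<close>.
  For \<open>m = 0\<close> only the empty simplex remains, and \<open>C\<^bsub>-1\<^esub>\<close> is the one-dimensional space
  that makes the chain complex the augmented one, hence the homology the reduced one.
  The ring multiplication and unit of the record play no role in a module.\<close>

definition oriented_chains :: "'a set set \<Rightarrow> nat \<Rightarrow> (real, 'a list \<Rightarrow> real) module" where
  "oriented_chains X m =
     \<lparr>carrier = {c. (\<forall>xs. c xs \<noteq> 0 \<longrightarrow> distinct xs \<and> length xs = m \<and> set xs \<in> X) \<and>
                    (\<forall>xs p. p permutes {..<length xs} \<longrightarrow>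
                       c (permute_list p xs) = of_int (sign p) * c xs)},
      mult = undefined, one = undefined,
      zero = (\<lambda>xs. 0), add = (\<lambda>c d xs. c xs + d xs), smult = (\<lambda>r c xs. r * c xs)\<rparr>"

text \<open>The boundary operator determined by
  \<open>\<partial>[x\<^sub>0, \<dots>, x\<^sub>k] = (\<Sum>i\<le>k. (-1)^i [x\<^sub>0, \<dots>, x\<^bsub>i-1\<^esub>, x\<^bsub>i+1\<^esub>, \<dots>, x\<^sub>k])\<close>, read off coefficientwise:
  the oriented simplices whose boundary contains \<open>xs\<close> are, up to sign, the \<open>v # xs\<close>,
  and \<open>xs\<close> has coefficient \<open>1\<close> in \<open>\<partial>(v # xs)\<close>. Lemma \<open>boundary_oriented_simplex\<close> below
  recovers the usual signs.\<close>

definition boundary :: "'a set set \<Rightarrow> ('a list \<Rightarrow> real) \<Rightarrow> 'a list \<Rightarrow> real" where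
  "boundary X c xs = (\<Sum>v\<in>\<Union>X. c (v # xs))"

definition cycles :: "'a set set \<Rightarrow> nat \<Rightarrow> ('a list \<Rightarrow> real) set" where
  "cycles X k = {c \<in> carrier (oriented_chains X (k + 1)). boundary X c = (\<lambda>xs. 0)}"

definition boundaries :: "'a set set \<Rightarrow> nat \<Rightarrow> ('a list \<Rightarrow> real) set" where
  "boundaries X k = boundary X ` carrier (oriented_chains X (k + 2))"

definition quotient_module :: "('r, 'm) module \<Rightarrow> 'm set \<Rightarrow> ('r, 'm set) module" where
  "quotient_module M N =
     \<lparr>carrier = a_rcosets\<^bsub>M\<^esub> N, mult = undefined, one = undefined,
      zero = N, add = set_add M,
      smult = (\<lambda>r A. \<Union>x\<in>A. N +>\<^bsub>M\<^esub> (r \<odot>\<^bsub>M\<^esub> x))\<rparr>"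

definition reduced_homology ::
    "'a set set \<Rightarrow> nat \<Rightarrow> (real, ('a list \<Rightarrow> real) set) module" where
  "reduced_homology X k =
     quotient_module ((oriented_chains X (k + 1))\<lparr>carrier := cycles X k\<rparr>) (boundaries X k)"

section \<open>Adequacy of the definitions\<close>

text \<open>The homology of a simplicial complex is a real vector space, so that \<open>vectorspace.dim\<close> may
  be applied to it.\<close>

lemma quotient_module_vectorspace:
  fixes K (structure) and M (structure)
  assumes "vectorspace K M" and "submodule K N M"
  shows "vectorspace K (quotient_module M N)"
proof -
  interpret vectorspace K M by fact
  interpret N: submodule K N M by fact
  have NM: "N \<subseteq> carrier M" using N.subset by simp
  have "\<ominus>\<^bsub>M\<^esub> x \<in> N" if "x \<in> N" for x
  proof -
    have "\<ominus>\<^bsub>M\<^esub> x = (\<ominus> \<one>) \<odot>\<^bsub>M\<^esub> x"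
      using that NM by (simp add: smult_l_minus subset_iff)
    thus ?thesis using that N.smult_closed by auto
  qed
  hence sub: "additive_subgroup N M"
    using N.m_closed N.zero_closed NM
    by (intro additive_subgroup.intro subgroup.intro) (auto simp: a_inv_def)
  interpret abelian_subgroup N M
    by (rule abelian_subgroupI3[OF sub]) unfold_locales
  let ?Q = "quotient_module M N"
  have carr: "carrier ?Q = {N +>\<^bsub>M\<^esub> x |x. x \<in> carrier M}"
    by (auto simp: quotient_module_def A_RCOSETS_def')
  have add: "(N +>\<^bsub>M\<^esub> x) \<oplus>\<^bsub>?Q\<^esub> (N +>\<^bsub>M\<^esub> y) = N +>\<^bsub>M\<^esub> (x \<oplus>\<^bsub>M\<^esub> y)"
    if "x \<in> carrier M" "y \<in> carrier M" for x y
    using that by (simp add: quotient_module_def a_rcos_sum)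
  have zero: "\<zero>\<^bsub>?Q\<^esub> = N +>\<^bsub>M\<^esub> \<zero>\<^bsub>M\<^esub>"
    using NM by (simp add: quotient_module_def)
  have smult: "r \<odot>\<^bsub>?Q\<^esub> (N +>\<^bsub>M\<^esub> x) = N +>\<^bsub>M\<^esub> (r \<odot>\<^bsub>M\<^esub> x)"
    if "x \<in> carrier M" "r \<in> carrier K" for r x
  proof -
    have "N +>\<^bsub>M\<^esub> (r \<odot>\<^bsub>M\<^esub> y) = N +>\<^bsub>M\<^esub> (r \<odot>\<^bsub>M\<^esub> x)" if y: "y \<in> N +>\<^bsub>M\<^esub> x" for y
    proof -
      obtain h where h: "h \<in> N" "y = h \<oplus>\<^bsub>M\<^esub> x" using y by (auto simp: a_r_coset_def')
      have "r \<odot>\<^bsub>M\<^esub> y = (r \<odot>\<^bsub>M\<^esub> h) \<oplus>\<^bsub>M\<^esub> (r \<odot>\<^bsub>M\<^esub> x)"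
        using h NM \<open>x \<in> carrier M\<close> \<open>r \<in> carrier K\<close> by (auto simp: smult_r_distr)
      moreover have "r \<odot>\<^bsub>M\<^esub> h \<in> N" using h \<open>r \<in> carrier K\<close> N.smult_closed by auto
      ultimately have "r \<odot>\<^bsub>M\<^esub> y \<in> N +>\<^bsub>M\<^esub> (r \<odot>\<^bsub>M\<^esub> x)" by (auto simp: a_r_coset_def')
      thus ?thesis using \<open>x \<in> carrier M\<close> \<open>r \<in> carrier K\<close> 
        by (metis a_repr_independence a_subgroup smult_closed)
    qed
    note eq = this
    have x: "x \<in> N +>\<^bsub>M\<^esub> x" using that a_rcos_self by auto
    have "(\<Union>y\<in>N +>\<^bsub>M\<^esub> x. N +>\<^bsub>M\<^esub> (r \<odot>\<^bsub>M\<^esub> y)) = (\<Union>y\<in>N +>\<^bsub>M\<^esub> x. N +>\<^bsub>M\<^esub> (r \<odot>\<^bsub>M\<^esub> x))"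
      by (rule SUP_cong[OF refl eq])
    also have "\<dots> = N +>\<^bsub>M\<^esub> (r \<odot>\<^bsub>M\<^esub> x)" using x by blast
    finally show ?thesis by (simp add: quotient_module_def)
  qed
  have "module K ?Q"
  proof (rule moduleI)
    show "cring K" by unfold_locales
    show "abelian_group ?Q"
    proof (rule abelian_groupI)
      fix A assume "A \<in> carrier ?Q"
      then obtain x where x: "x \<in> carrier M" "A = N +>\<^bsub>M\<^esub> x" unfolding carr by auto
      show "\<zero>\<^bsub>?Q\<^esub> \<oplus>\<^bsub>?Q\<^esub> A = A" using x by (simp add: zero add)
      show "\<exists>y\<in>carrier ?Q. y \<oplus>\<^bsub>?Q\<^esub> A = \<zero>\<^bsub>?Q\<^esub>"
        by (rule bexI[of _ "N +>\<^bsub>M\<^esub> (\<ominus>\<^bsub>M\<^esub> x)"]) (use x in \<open>auto simp: zero add carr M.l_neg\<close>)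
    next
      show "\<zero>\<^bsub>?Q\<^esub> \<in> carrier ?Q" unfolding carr zero by blast
    qed (auto simp: carr add M.a_ac)
  qed (auto simp: carr smult add smult_l_distr smult_r_distr smult_assoc1)
  thus ?thesis unfolding vectorspace_def by (auto intro: field_axioms)
qed

lemma oriented_chains_vectorspace: "vectorspace class_ring (oriented_chains X m)"
proof -
  let ?C = "oriented_chains X m"
  have ac: "(\<lambda>xs. a * c xs) \<in> carrier ?C" if "c \<in> carrier ?C" for a c
    using that by (auto simp: oriented_chains_def algebra_simps)
  have "abelian_group ?C"
  proof (rule abelian_groupI)
    fix c assume c: "c \<in> carrier ?C"
    show "\<exists>d\<in>carrier ?C. d \<oplus>\<^bsub>?C\<^esub> c = \<zero>\<^bsub>?C\<^esub>"
      by (rule bexI[OF _ ac[OF c, of "-1"]]) (simp add: oriented_chains_def)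
  next
    fix c d assume "c \<in> carrier ?C" "d \<in> carrier ?C"
    thus "c \<oplus>\<^bsub>?C\<^esub> d \<in> carrier ?C"
      by (auto simp: oriented_chains_def algebra_simps) (metis add.right_neutral)+
  qed (auto simp: oriented_chains_def algebra_simps)
  moreover have "field (class_ring :: real ring)" by (rule class_field)
  ultimately show ?thesis using ac unfolding vectorspace_def
    by (auto intro!: moduleI fieldE simp: oriented_chains_def algebra_simps field.axioms domain.axioms)
qed

lemma boundary_in_chains:
  assumes X: "\<And>S T. S \<in> X \<Longrightarrow> T \<subseteq> S \<Longrightarrow> T \<in> X"
    and c: "c \<in> carrier (oriented_chains X (Suc m))"
  shows "boundary X c \<in> carrier (oriented_chains X m)"
proof -
  have supp: "distinct xs \<and> length xs = Suc m \<and> set xs \<in> X" if "c xs \<noteq> 0" for xs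
    using c that by (simp add: oriented_chains_def)
  have alt: "c (permute_list p xs) = of_int (sign p) * c xs" if "p permutes {..<length xs}" for p xs
    using c that by (simp add: oriented_chains_def)
  have "distinct xs \<and> length xs = m \<and> set xs \<in> X" if "boundary X c xs \<noteq> 0" for xs
  proof -
    have "\<exists>v. c (v # xs) \<noteq> 0"
    proof (rule ccontr)
      assume "\<nexists>v. c (v # xs) \<noteq> 0"
      thus False using that by (simp add: boundary_def)
    qed
    then obtain v where "c (v # xs) \<noteq> 0" by blast
    from supp[OF this] show ?thesis using X[of "set (v # xs)" "set xs"] by auto
  qed
  moreover have "boundary X c (permute_list p xs) = of_int (sign p) * boundary X c xs"
    if p: "p permutes {..<length xs}" for xs p
  proof -
    define q where "q = map_permutation {..<length xs} Suc p"
    have q: "q permutes {..<length (v # xs)}" for v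
      using map_permutation_permutes[of Suc "{..<length xs}" "Suc ` {..<length xs}" p] p
      unfolding q_def by (auto simp: bij_betw_def intro: permutes_subset)
    have q0: "q 0 = 0"
      using map_permutation_permutes[of Suc "{..<length xs}" "Suc ` {..<length xs}" p] p
      unfolding q_def by (auto simp: bij_betw_def permutes_def)
    have qS: "q (Suc i) = Suc (p i)" if "i < length xs" for i
      unfolding q_def using that by (intro map_permutation_apply) auto
    have sq: "sign q = sign p"
      unfolding q_def using p by (intro sign_map_permutation) auto
    have "v # permute_list p xs = permute_list q (v # xs)" for v
    proof (rule nth_equalityI)
      fix i assume "i < length (v # permute_list p xs)"
      thus "(v # permute_list p xs) ! i = permute_list q (v # xs) ! i"
        by (subst permute_list_nth[OF q], simp, cases i) (auto simp: q0 qS permute_list_nth[OF p])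
    qed simp
    thus ?thesis by (simp add: boundary_def alt[OF q] sq sum_distrib_left)
  qed
  ultimately show ?thesis by (simp add: oriented_chains_def)
qed

lemma oriented_chain_swap:
  assumes c: "c \<in> carrier (oriented_chains X m)"
  shows "c (as @ y # x # bs) = - c (as @ x # y # bs)"
proof -
  let ?n = "length as" let ?p = "transpose (length as) (Suc (length as))"
  let ?xs = "as @ x # y # bs"
  have p: "?p permutes {..<length ?xs}" by (rule permutes_swap_id) auto
  have "as @ y # x # bs = permute_list ?p ?xs"
  proof (rule nth_equalityI)
    fix i assume "i < length (as @ y # x # bs)"
    thus "(as @ y # x # bs) ! i = permute_list ?p ?xs ! i"
      by (subst permute_list_nth[OF p], simp)
         (auto simp: nth_append transpose_def nth_Cons split: nat.splits)
  qed simp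
  thus ?thesis using c p by (simp add: oriented_chains_def sign_swap_id)
qed

lemma oriented_chain_move:
  assumes c: "c \<in> carrier (oriented_chains X m)"
  shows "c (x # as @ bs) = (-1) ^ length as * c (as @ x # bs)"
proof (induction as arbitrary: bs rule: rev_induct)
  case (snoc a as)
  show ?case using snoc.IH[of "a # bs"] oriented_chain_swap[OF c, of as x a bs] by simp
qed simp

lemma boundary_boundary:
  assumes c: "c \<in> carrier (oriented_chains X m)"
  shows "boundary X (boundary X c) = (\<lambda>xs. 0)"
proof
  fix xs
  let ?s = "\<Sum>v\<in>\<Union>X. \<Sum>u\<in>\<Union>X. c (u # v # xs)"
  have "?s = (\<Sum>v\<in>\<Union>X. \<Sum>u\<in>\<Union>X. - c (v # u # xs))"
    by (intro sum.cong refl) (rule oriented_chain_swap[OF c, of "[]", unfolded append_Nil])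
  also have "\<dots> = - ?s" by (subst sum.swap) (simp add: sum_negf)
  finally show "boundary X (boundary X c) xs = 0" by (simp add: boundary_def)
qed

text \<open>The chain \<open>c\<close> is the oriented simplex \<open>as @ x # bs\<close>; its boundary contains the face
  opposite to \<open>x\<close> with the sign given by the position of \<open>x\<close>.\<close>

lemma boundary_oriented_simplex:
  assumes fin: "finite (\<Union>X)" and c: "c \<in> carrier (oriented_chains X m)"
    and xs: "c (as @ x # bs) = 1"
    and supp: "\<And>ys. c ys \<noteq> 0 \<Longrightarrow> set ys = set (as @ x # bs)"
  shows "boundary X c (as @ bs) = (-1) ^ length as"
proof -
  have s: "distinct ys \<and> length ys = m \<and> set ys \<in> X" if "c ys \<noteq> 0" for ys
    using c that by (simp add: oriented_chains_def)
  have "c (v # as @ bs) = (if v = x then (-1) ^ length as else 0)" for v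
  proof (cases "v = x \<or> c (v # as @ bs) = 0")
    case False
    thus ?thesis using supp[of "v # as @ bs"] s[of "v # as @ bs"] s[of "as @ x # bs"] xs by auto
  next
    case True
    have "c (x # as @ bs) = (-1) ^ length as" using oriented_chain_move[OF c, of x as bs] xs by simp
    thus ?thesis using True by auto
  qed
  moreover have "x \<in> \<Union>X" using s[of "as @ x # bs"] xs by auto
  ultimately show ?thesis using fin by (simp add: boundary_def)
qed

lemma reduced_homology_vectorspace:
  assumes X: "\<And>S T. S \<in> X \<Longrightarrow> T \<subseteq> S \<Longrightarrow> T \<in> X"
  shows "vectorspace class_ring (reduced_homology X k)"
proof -
  let ?C = "oriented_chains X (k + 1)" let ?Z = "?C\<lparr>carrier := cycles X k\<rparr>"
  interpret C: vectorspace class_ring ?C by (rule oriented_chains_vectorspace)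
  interpret D: vectorspace class_ring "oriented_chains X (k + 2)" by (rule oriented_chains_vectorspace)
  have lin: "boundary X (\<lambda>xs. c xs + d xs) = (\<lambda>xs. boundary X c xs + boundary X d xs)"
    "boundary X (\<lambda>xs. r * c xs) = (\<lambda>xs. r * boundary X c xs)" "boundary X (\<lambda>xs. 0) = (\<lambda>xs. 0)" for c d r
    by (auto simp: boundary_def sum.distrib sum_distrib_left)
  have ops: "add (oriented_chains X m) = (\<lambda>c d xs. c xs + d xs)" "\<zero>\<^bsub>oriented_chains X m\<^esub> = (\<lambda>xs. 0)"
    "module.smult (oriented_chains X m) = (\<lambda>r c xs. r * c xs)" for m
    by (simp_all add: oriented_chains_def)
  have "submodule class_ring (cycles X k) ?C"
    using C.module_axioms C.M.add.m_closed C.smult_closed C.M.zero_closed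
    by (intro submodule.intro) (auto simp: cycles_def ops lin)
  hence Z: "vectorspace class_ring ?Z"
    using C.submodule_is_module class_field by (auto simp: vectorspace_def)
  then interpret Z: vectorspace class_ring ?Z .
  have sub: "boundaries X k \<subseteq> cycles X k"
    using boundary_in_chains[OF X, where m = "k + 1"] boundary_boundary
    by (fastforce simp: boundaries_def cycles_def)
  have "submodule class_ring (boundaries X k) ?Z"
  proof (rule submodule.intro)
    show "\<zero>\<^bsub>?Z\<^esub> \<in> boundaries X k"
      using lin(3) D.M.zero_closed unfolding boundaries_def by (auto simp: ops intro!: image_eqI)
  next
    fix a b assume "a \<in> boundaries X k" "b \<in> boundaries X k"
    thus "a \<oplus>\<^bsub>?Z\<^esub> b \<in> boundaries X k"
      unfolding boundaries_def using D.M.add.m_closed by (auto simp: ops lin(1)[symmetric])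
  next
    fix r a assume "a \<in> boundaries X k"
    thus "r \<odot>\<^bsub>?Z\<^esub> a \<in> boundaries X k"
      unfolding boundaries_def using D.smult_closed[of r] by (auto simp: ops lin(2)[symmetric])
  qed (use Z.module_axioms sub in auto)
  thus ?thesis unfolding reduced_homology_def by (rule quotient_module_vectorspace[OF Z])
qed

end

theory Submission
  imports Defs
begin

text \<open>Let \<open>W\<close> be the total weight, \<open>s v = sqrt (w v)\<close>, and let \<open>S\<close> be the symmetric matrix with the
  diagonal of the Laplacian and entries \<open>- s u * s v\<close> on edges. Every term of the Leibniz expansion
  is the same for \<open>S\<close> and for the Laplacian, so they have the same characteristic polynomial and \<open>S\<close>
  has an orthonormal eigenbasis for the eigenvalues \<open>l\<close>.

  Weight the boundary operator and its adjoint by \<open>s\<close> and let \<open>c\<close> be a harmonic \<open>k\<close>-chain. The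
  extension of \<open>S\<close> as a derivation to alternating tensors satisfies \<open>(S c) x = r x * c x\<close> on the
  simplices \<open>x\<close>, with \<open>r x \<ge> W\<close>, because the off-diagonal terms cancel by harmonicity. In the eigenbasis,
  this derivation is diagonal with the sums \<open>\<Sum>i\<in>I. l i\<close> as eigenvalues. So \<open>c = 0\<close> as soon as its
  coordinates at all \<open>I\<close> with \<open>(\<Sum>i\<in>I. l i) \<ge> W\<close> vanish.

  If the homology had a larger dimension than there are such \<open>I\<close>, then for every positive \<open>s\<close> there
  would be a unit harmonic chain with all these coordinates zero. Since \<open>w\<close> may vanish, such chains
  are taken for \<open>s + 1 / (j + 1)\<close>, and a convergent subsequence of them gives the contradiction.\<close>

section \<open>Linear algebra of real functions\<close>

text \<open>Gaussian elimination: an unknown \<open>p\<close> that occurs in the equation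
  \<open>j\<close> is eliminated from the remaining equations, which leaves one equation and one
  unknown fewer.\<close>

lemma homogeneous_system_nontrivial:
  fixes M :: "'j \<Rightarrow> 'i \<Rightarrow> real"
  assumes "finite J" "finite I" "card J < card I"
  shows "\<exists>a. (\<exists>i\<in>I. a i \<noteq> 0) \<and> (\<forall>j\<in>J. (\<Sum>i\<in>I. M j i * a i) = 0)"
  using assms
proof (induction J arbitrary: I M rule: finite_induct)
  case empty
  then have "I \<noteq> {}" by auto
  then show ?case by (intro exI[of _ "\<lambda>_. 1"]) auto
next
  case (insert j J)
  show ?case
  proof (cases "\<forall>i\<in>I. M j i = 0")
    case True
    have "card J < card I" using insert by simp
    then obtain a where "\<exists>i\<in>I. a i \<noteq> 0" "\<forall>k\<in>J. (\<Sum>i\<in>I. M k i * a i) = 0"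
      using insert.IH[OF insert.prems(1)] by blast
    with True show ?thesis by (intro exI[of _ a]) auto
  next
    case False
    then obtain p where p: "p \<in> I" "M j p \<noteq> 0" by auto
    let ?I = "I - {p}"
    have "card J < card ?I" using insert p by simp
    then obtain a where a: "\<exists>i\<in>?I. a i \<noteq> 0"
        "\<And>k. k \<in> J \<Longrightarrow> (\<Sum>i\<in>?I. (M k i - M k p / M j p * M j i) * a i) = 0"
      using insert.IH[of ?I "\<lambda>k i. M k i - M k p / M j p * M j i"] insert.prems(1) by auto
    \<comment> \<open>The value at \<open>p\<close> is the one that solves the equation
      \<open>j\<close>; the other equations then follow from their reduced forms.\<close>
    define b where "b = a(p := - (\<Sum>i\<in>?I. M j i * a i) / M j p)"
    have at_p: "(\<Sum>i\<in>I. M k i * b i) = M k p * b p + (\<Sum>i\<in>?I. M k i * a i)" for k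
      by (subst sum.remove[OF insert.prems(1) p(1)]) (auto simp: b_def intro!: sum.cong)
    have "(\<Sum>i\<in>I. M j i * b i) = 0"
      using p(2) by (simp only: at_p) (simp add: b_def)
    moreover have "(\<Sum>i\<in>I. M k i * b i) = 0" if "k \<in> J" for k
    proof -
      have "0 = (\<Sum>i\<in>?I. M k i * a i) - M k p / M j p * (\<Sum>i\<in>?I. M j i * a i)"
        using a(2)[OF that] by (simp add: left_diff_distrib sum_subtractf sum_distrib_left mult.assoc)
      then show ?thesis unfolding at_p by (simp add: b_def)
    qed
    moreover have "\<exists>i\<in>I. b i \<noteq> 0" using a(1) by (auto simp: b_def)
    ultimately show ?thesis by (intro exI[of _ b]) auto
  qed
qed

section \<open>Independence and spanning modulo a subspace of functions\<close>

definition fun_subspace :: "('b \<Rightarrow> real) set \<Rightarrow> bool" where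
  "fun_subspace B \<longleftrightarrow> (\<lambda>x. 0) \<in> B \<and> (\<forall>c\<in>B. \<forall>d\<in>B. (\<lambda>x. c x + d x) \<in> B) \<and>
     (\<forall>c\<in>B. \<forall>r. (\<lambda>x. r * c x) \<in> B)"

lemma fun_subspace_smult: "fun_subspace B \<Longrightarrow> c \<in> B \<Longrightarrow> (\<lambda>x. r * c x) \<in> B"
  by (simp add: fun_subspace_def)

lemma fun_subspace_sum:
  assumes "fun_subspace B" "finite I" "\<And>i. i \<in> I \<Longrightarrow> z i \<in> B"
  shows "(\<lambda>x. \<Sum>i\<in>I. a i * z i x) \<in> B"
  using assms(2,3)
proof (induction I rule: finite_induct)
  case empty then show ?case using assms(1) by (simp add: fun_subspace_def)
next
  case (insert j I)
  then have "(\<lambda>x. a j * z j x) \<in> B" "(\<lambda>x. \<Sum>i\<in>I. a i * z i x) \<in> B"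
    using assms(1) by (auto simp: fun_subspace_def)
  then show ?case using insert assms(1) by (simp add: fun_subspace_def)
qed

lemma fun_subspace_zero: "fun_subspace {\<lambda>x. 0}"
  by (simp add: fun_subspace_def)

text \<open>Linear independence of the classes of the \<open>z i\<close> modulo \<open>B\<close>,
  phrased without a quotient space; the zero subspace as \<open>B\<close> gives ordinary linear
  independence.\<close>

definition indep_mod :: "('b \<Rightarrow> real) set \<Rightarrow> nat \<Rightarrow> (nat \<Rightarrow> 'b \<Rightarrow> real) \<Rightarrow> bool" where
  "indep_mod B n z \<longleftrightarrow> (\<forall>a. (\<lambda>x. \<Sum>i<n. a i * z i x) \<in> B \<longrightarrow> (\<forall>i<n. a i = 0))"

definition spans_mod :: "('b \<Rightarrow> real) set \<Rightarrow> ('b \<Rightarrow> real) set \<Rightarrow> nat \<Rightarrow> (nat \<Rightarrow> 'b \<Rightarrow> real) \<Rightarrow> bool" where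
  "spans_mod Z B n z \<longleftrightarrow> (\<forall>i<n. z i \<in> Z) \<and> (\<forall>c\<in>Z. \<exists>a. (\<lambda>x. c x - (\<Sum>i<n. a i * z i x)) \<in> B)"

lemma indep_mod_extend:
  assumes B: "fun_subspace B" and z: "indep_mod B n z"
    and c: "\<And>a. (\<lambda>x. c x - (\<Sum>i<n. a i * z i x)) \<notin> B"
  shows "indep_mod B (Suc n) (z(n := c))"
  unfolding indep_mod_def
proof (rule allI, rule impI)
  fix a assume "(\<lambda>x. \<Sum>i<Suc n. a i * (z(n := c)) i x) \<in> B"
  then have *: "(\<lambda>x. (\<Sum>i<n. a i * z i x) + a n * c x) \<in> B" by simp
  have an: "a n = 0"
  proof (rule ccontr)
    assume "a n \<noteq> 0"
    have "(\<lambda>x. (1 / a n) * ((\<Sum>i<n. a i * z i x) + a n * c x)) \<in> B"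
      by (rule fun_subspace_smult[OF B *])
    also have "(\<lambda>x. (1 / a n) * ((\<Sum>i<n. a i * z i x) + a n * c x))
        = (\<lambda>x. c x - (\<Sum>i<n. (- a i / a n) * z i x))"
      using \<open>a n \<noteq> 0\<close> by (auto simp: fun_eq_iff field_simps sum_negf sum_divide_distrib[symmetric])
    finally show False using c[of "\<lambda>i. - a i / a n"] by simp
  qed
  with * z have "\<forall>i<n. a i = 0" by (simp add: indep_mod_def)
  with an show "\<forall>i<Suc n. a i = 0" by (simp add: less_Suc_eq)
qed

text \<open>An independent family is enlarged one member at a time. This gets stuck only at a family
  that spans already, and that family has fewer than \<open>n\<close> members.\<close>

lemma indep_or_spans:
  assumes "fun_subspace B"
  shows "(\<exists>z. (\<forall>i<n. z i \<in> Z) \<and> indep_mod B n z) \<or> (\<exists>m<n. \<exists>z. spans_mod Z B m z)"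
proof (induction n)
  case 0
  show ?case by (simp add: indep_mod_def)
next
  case (Suc n)
  show ?case
  proof (cases "\<exists>m<Suc n. \<exists>z. spans_mod Z B m z")
    case False
    with Suc obtain z where z: "\<forall>i<n. z i \<in> Z" "indep_mod B n z" using less_SucI by blast
    with False have "\<not> spans_mod Z B n z" by blast
    then obtain c where "c \<in> Z" "\<And>a. (\<lambda>x. c x - (\<Sum>i<n. a i * z i x)) \<notin> B"
      using z(1) by (auto simp: spans_mod_def)
    then have "indep_mod B (Suc n) (z(n := c))" "\<forall>i<Suc n. (z(n := c)) i \<in> Z"
      using indep_mod_extend[OF assms z(2)] z(1) by (auto simp: less_Suc_eq)
    then show ?thesis by blast
  qed blast
qed

text \<open>One equation for each point of \<open>\<Omega>\<close>: more functions than points have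
  a nontrivial combination that vanishes everywhere.\<close>

lemma indep_finite_support:
  assumes "finite \<Omega>" "\<And>i x. i < n \<Longrightarrow> x \<notin> \<Omega> \<Longrightarrow> z i x = 0" and "indep_mod {\<lambda>x. 0} n z"
  shows "n \<le> card \<Omega>"
proof (rule ccontr)
  assume "\<not> n \<le> card \<Omega>"
  then obtain a where a: "\<exists>i<n. a i \<noteq> 0" "\<forall>x\<in>\<Omega>. (\<Sum>i<n. z i x * a i) = 0"
    using homogeneous_system_nontrivial[OF assms(1), of "{..<n}" "\<lambda>x i. z i x"] by auto
  have "(\<lambda>x. \<Sum>i<n. a i * z i x) = (\<lambda>x. 0)"
  proof
    fix x show "(\<Sum>i<n. a i * z i x) = 0"
      using a(2) assms(2) by (cases "x \<in> \<Omega>") (auto simp: mult.commute)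
  qed
  with assms(3) a(1) show False by (auto simp: indep_mod_def)
qed

text \<open>The size of an independent family in \<open>B\<close> is bounded by
  \<open>card \<Omega>\<close>, so a largest one exists; it spans, since otherwise it could be
  extended.\<close>

lemma finite_support_basis:
  assumes B: "fun_subspace B" and "finite \<Omega>" "\<And>b x. b \<in> B \<Longrightarrow> x \<notin> \<Omega> \<Longrightarrow> b x = 0"
  obtains r b where "\<And>i. i < r \<Longrightarrow> b i \<in> B" "indep_mod {\<lambda>x. 0} r b"
    "\<And>c. c \<in> B \<Longrightarrow> \<exists>\<beta>. c = (\<lambda>x. \<Sum>i<r. \<beta> i * b i x)"
proof -
  let ?P = "\<lambda>r. \<exists>b. (\<forall>i<r. b i \<in> B) \<and> indep_mod {\<lambda>x. 0} r b"
  have bd: "\<forall>r. ?P r \<longrightarrow> r \<le> card \<Omega>"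
    using indep_finite_support[OF assms(2)] assms(3) by metis
  have "?P 0" by (simp add: indep_mod_def)
  define r where "r = Greatest ?P"
  have "?P r" unfolding r_def by (rule GreatestI_nat[of ?P, OF \<open>?P 0\<close> bd[rule_format]])
  then obtain b where b: "\<forall>i<r. b i \<in> B" "indep_mod {\<lambda>x. 0} r b" by blast
  have "\<exists>\<beta>. c = (\<lambda>x. \<Sum>i<r. \<beta> i * b i x)" if c: "c \<in> B" for c
  proof (rule ccontr)
    assume "\<not> ?thesis"
    then have "(\<lambda>x. c x - (\<Sum>i<r. a i * b i x)) \<notin> {\<lambda>x. 0}" for a
      by (auto simp: fun_eq_iff)
    then have "indep_mod {\<lambda>x. 0} (Suc r) (b(r := c))"
      using indep_mod_extend[OF fun_subspace_zero b(2)] by blast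
    moreover have "\<forall>i<Suc r. (b(r := c)) i \<in> B" using b(1) c by (auto simp: less_Suc_eq)
    ultimately have "?P (Suc r)" by blast
    from Greatest_le_nat[of ?P, OF this bd[rule_format]] show False by (simp add: r_def)
  qed
  then show thesis using b that by blast
qed

text \<open>A dimension count. Take \<open>card J + 1\<close> elements of \<open>Z\<close> that are
  independent modulo \<open>B\<close> together with a basis of \<open>B\<close> of size
  \<open>r\<close>: their combinations have \<open>card J + 1 + r\<close> coefficients, while only
  \<open>card J + r\<close> equations are imposed.\<close>

lemma orthogonal_representative:
  assumes Z: "fun_subspace Z" and B: "fun_subspace B" "B \<subseteq> Z"
    and \<Omega>: "finite \<Omega>" "\<And>c x. c \<in> Z \<Longrightarrow> x \<notin> \<Omega> \<Longrightarrow> c x = 0"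
    and J: "finite J" and nospan: "\<And>m z. m \<le> card J \<Longrightarrow> \<not> spans_mod Z B m z"
  shows "\<exists>c\<in>Z. c \<noteq> (\<lambda>x. 0) \<and> (\<forall>j\<in>J. (\<Sum>x\<in>\<Omega>. \<phi> j x * c x) = 0) \<and>
      (\<forall>b\<in>B. (\<Sum>x\<in>\<Omega>. \<rho> x * c x * b x) = (0::real))"
proof -
  obtain z where z: "\<forall>i<Suc (card J). z i \<in> Z" "indep_mod B (Suc (card J)) z"
    using indep_or_spans[OF B(1), of "Suc (card J)" Z] nospan by (auto simp: less_Suc_eq_le)
  obtain r b where b: "\<And>i. i < r \<Longrightarrow> b i \<in> B" "indep_mod {\<lambda>x. 0} r b"
    "\<And>c. c \<in> B \<Longrightarrow> \<exists>\<beta>. c = (\<lambda>x. \<Sum>i<r. \<beta> i * b i x)"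
    using finite_support_basis[OF B(1) \<Omega>(1)] \<Omega>(2) B(2) by blast
  let ?n = "Suc (card J)"
  define I where "I = {..<?n} <+> {..<r}"
  have fI: "finite I" by (simp add: I_def)
  define y where "y = case_sum z b"
  define M where "M = case_sum (\<lambda>j i. \<Sum>x\<in>\<Omega>. \<phi> j x * y i x) (\<lambda>l i. \<Sum>x\<in>\<Omega>. \<rho> x * y i x * b l x)"
  have "card (J <+> {..<r}) < card I"
    using J by (simp add: I_def card_Plus)
  then obtain a where a: "\<exists>i\<in>I. a i \<noteq> 0" "\<forall>j\<in>J <+> {..<r}. (\<Sum>i\<in>I. M j i * a i) = 0"
    using homogeneous_system_nontrivial[of "J <+> {..<r}" I M] J fI by auto
  define c where "c = (\<lambda>x. \<Sum>i\<in>I. a i * y i x)"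
  have csplit: "c = (\<lambda>x. (\<Sum>i<?n. a (Inl i) * z i x) + (\<Sum>i<r. a (Inr i) * b i x))"
    by (simp add: c_def I_def sum.Plus y_def o_def)
  have pull: "(\<Sum>x\<in>\<Omega>. g x * c x) = (\<Sum>i\<in>I. (\<Sum>x\<in>\<Omega>. g x * y i x) * a i)" for g
    unfolding c_def sum_distrib_left sum_distrib_right
    by (subst sum.swap) (simp add: mult_ac)
  have "c \<in> Z" unfolding c_def
    by (rule fun_subspace_sum[OF Z fI]) (use z(1) b(1) B(2) in \<open>auto simp: I_def y_def\<close>)
  \<comment> \<open>Independence modulo \<open>B\<close> forces the coefficients of the
    \<open>z i\<close> to vanish, and then independence of the basis of \<open>B\<close> does so for
    the others.\<close>
  moreover have "c \<noteq> (\<lambda>x. 0)"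
  proof
    assume c0: "c = (\<lambda>x. 0)"
    have "(\<lambda>x. \<Sum>i<r. (- a (Inr i)) * b i x) \<in> B"
      by (rule fun_subspace_sum[OF B(1)]) (use b(1) in auto)
    also have "(\<lambda>x. \<Sum>i<r. (- a (Inr i)) * b i x) = (\<lambda>x. \<Sum>i<?n. a (Inl i) * z i x)"
    proof
      fix x show "(\<Sum>i<r. (- a (Inr i)) * b i x) = (\<Sum>i<?n. a (Inl i) * z i x)"
        using fun_cong[OF c0[unfolded csplit], of x] by (simp add: sum_negf)
    qed
    finally have l: "\<forall>i<?n. a (Inl i) = 0"
      using z(2)[unfolded indep_mod_def, rule_format, of "\<lambda>i. a (Inl i)"] by blast
    then have "(\<lambda>x. \<Sum>i<r. a (Inr i) * b i x) = (\<lambda>x. 0)"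
      using c0 unfolding csplit by (auto simp: fun_eq_iff)
    then have "\<forall>i<r. a (Inr i) = 0"
      using b(2)[unfolded indep_mod_def, rule_format, of "\<lambda>i. a (Inr i)"] by blast
    with l a(1) show False by (auto simp: I_def)
  qed
  moreover have "(\<Sum>x\<in>\<Omega>. \<phi> j x * c x) = 0" if "j \<in> J" for j
    using bspec[OF a(2), of "Inl j"] that unfolding pull by (auto simp: M_def)
  moreover have "(\<Sum>x\<in>\<Omega>. \<rho> x * c x * d x) = 0" if d: "d \<in> B" for d
  proof -
    obtain \<beta> where \<beta>: "d = (\<lambda>x. \<Sum>l<r. \<beta> l * b l x)" using b(3)[OF d] by blast
    have "(\<Sum>x\<in>\<Omega>. \<rho> x * c x * b l x) = 0" if "l < r" for l
    proof -
      have "(\<Sum>x\<in>\<Omega>. \<rho> x * c x * b l x) = (\<Sum>x\<in>\<Omega>. (\<rho> x * b l x) * c x)" by (simp add: mult_ac)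
      also have "\<dots> = 0"
        using bspec[OF a(2), of "Inr l"] that unfolding pull by (auto simp: M_def mult_ac)
      finally show ?thesis .
    qed
    moreover have "(\<Sum>x\<in>\<Omega>. \<rho> x * c x * d x) = (\<Sum>l<r. \<beta> l * (\<Sum>x\<in>\<Omega>. \<rho> x * c x * b l x))"
      unfolding \<beta> sum_distrib_left by (subst sum.swap) (simp add: mult_ac)
    ultimately show ?thesis by simp
  qed
  ultimately show ?thesis by blast
qed

text \<open>The points of \<open>\<Omega>\<close> are treated one after another: at each a monotone
  subsequence is extracted, and it converges because it is bounded.\<close>

lemma bounded_functions_convergent_subsequence:
  fixes f :: "nat \<Rightarrow> 'b \<Rightarrow> real"
  assumes "finite \<Omega>" "\<And>n x. x \<in> \<Omega> \<Longrightarrow> \<bar>f n x\<bar> \<le> C"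
  shows "\<exists>r c. strict_mono (r :: nat \<Rightarrow> nat) \<and> (\<forall>x\<in>\<Omega>. (\<lambda>n. f (r n) x) \<longlonglongrightarrow> c x)"
  using assms
proof (induction \<Omega> rule: finite_induct)
  case empty
  show ?case by (intro exI[of _ id]) (simp add: strict_mono_def)
next
  case (insert y \<Omega>)
  have "\<exists>r c. strict_mono (r :: nat \<Rightarrow> nat) \<and> (\<forall>x\<in>\<Omega>. (\<lambda>n. f (r n) x) \<longlonglongrightarrow> c x)"
    using insert.prems by (intro insert.IH) auto
  then obtain r c where r: "strict_mono (r :: nat \<Rightarrow> nat)" "\<And>x. x \<in> \<Omega> \<Longrightarrow> (\<lambda>n. f (r n) x) \<longlonglongrightarrow> c x"
    by blast
  obtain t where t: "strict_mono t" "monoseq (\<lambda>n. f (r (t n)) y)"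
    using seq_monosub[of "\<lambda>n. f (r n) y"] by auto
  have "Bseq (\<lambda>n. f (r (t n)) y)" using insert.prems by (intro BseqI'[of _ C]) simp
  then obtain d where d: "(\<lambda>n. f (r (t n)) y) \<longlonglongrightarrow> d"
    using Bseq_monoseq_convergent[OF _ t(2)] by (auto simp: convergent_def)
  have "(\<lambda>n. f (r (t n)) x) \<longlonglongrightarrow> (c(y := d)) x" if "x \<in> insert y \<Omega>" for x
    using that d LIMSEQ_subseq_LIMSEQ[OF r(2) t(1)] insert.hyps(2) by (auto simp: o_def)
  moreover have "strict_mono (\<lambda>n. r (t n))" using strict_mono_o[OF r(1) t(1)] by (simp add: o_def)
  ultimately show ?case by blast
qed

section \<open>Alternating functions on words\<close>

text \<open>Adjacent swaps generate all permutations, and a condition on them is inherited when a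
  fixed word is prefixed. This suits inductions over lists better than the condition on
  permutations.\<close>

definition swap_alt :: "('a list \<Rightarrow> real) \<Rightarrow> bool" where
  "swap_alt f \<longleftrightarrow> (\<forall>as x y bs. f (as @ y # x # bs) = - f (as @ x # y # bs))"

lemma swap_altD: "swap_alt f \<Longrightarrow> f (as @ y # x # bs) = - f (as @ x # y # bs)"
  unfolding swap_alt_def by blast

lemma swap_alt_append: "swap_alt f \<Longrightarrow> swap_alt (\<lambda>xs. f (as @ xs))"
  unfolding swap_alt_def by (metis append.assoc)

lemma swap_alt_Cons: "swap_alt f \<Longrightarrow> swap_alt (\<lambda>xs. f (v # xs))"
  using swap_alt_append[of f "[v]"] by simp

lemma swap_alt_move:
  assumes "swap_alt f"
  shows "f (x # as @ bs) = (-1) ^ length as * f (as @ x # bs)"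
proof (induction as arbitrary: bs rule: rev_induct)
  case (snoc a as)
  show ?case using snoc.IH[of "a # bs"] swap_altD[OF assms, of as x a bs] by simp
qed simp

text \<open>Absolute values make it unnecessary to track a sign: \<open>x\<close> is moved to the
  front of \<open>ys\<close>, and the induction hypothesis is applied to the function with
  \<open>x\<close> fixed in front.\<close>

lemma swap_alt_mset:
  "swap_alt f \<Longrightarrow> mset xs = mset ys \<Longrightarrow> \<bar>f xs\<bar> = \<bar>f ys\<bar>"
proof (induction xs arbitrary: f ys)
  case (Cons x xs)
  then have "x \<in> set ys" by (metis list.set_intros(1) mset_eq_setD)
  then obtain as bs where ys: "ys = as @ x # bs" by (auto simp: in_set_conv_decomp)
  with Cons.prems have "mset xs = mset (as @ bs)" by simp
  from Cons.IH[OF swap_alt_Cons[OF Cons.prems(1)] this] show ?case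
    using swap_alt_move[OF Cons.prems(1), of x as bs] by (simp add: ys abs_mult power_abs)
qed simp

text \<open>Once two equal entries stand at the front, swapping them changes the sign of the value
  but not the list.\<close>

lemma swap_alt_not_distinct:
  assumes "swap_alt f" "\<not> distinct xs"
  shows "f xs = 0"
proof -
  obtain as x bs cs where xs: "xs = as @ [x] @ bs @ [x] @ cs"
    using not_distinct_decomp[OF assms(2)] by auto
  have "\<bar>f xs\<bar> = \<bar>f (x # x # as @ bs @ cs)\<bar>"
    by (rule swap_alt_mset[OF assms(1)]) (simp add: xs)
  moreover have "f (x # x # as @ bs @ cs) = 0"
    using swap_altD[OF assms(1), of "[]" x x "as @ bs @ cs"] by simp
  ultimately show ?thesis by simp
qed

text \<open>The link between deletions of entries, which occur in the coboundary, and substitutions,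
  which occur in the derivation of tensors.\<close>

lemma swap_alt_update:
  assumes "swap_alt f" "i < length xs"
  shows "f (xs[i := v]) = (-1) ^ i * f (v # take i xs @ drop (Suc i) xs)"
  using swap_alt_move[OF assms(1), of v "take i xs" "drop (Suc i) xs"] assms(2)
  by (simp add: upd_conv_take_nth_drop mult.assoc[symmetric] power_mult_distrib[symmetric])

text \<open>Moving each of the two entries past the block between them gives the same sign twice, so
  a single adjacent swap remains.\<close>

lemma swap_alt_transpose_less:
  assumes f: "swap_alt f" and ab: "a < b" "b < length xs"
  shows "f (permute_list (transpose a b) xs) = - f xs"
proof -
  obtain as x us where xs: "xs = as @ x # us" "length as = a"
    using ab id_take_nth_drop[of a xs] by (metis length_take less_trans min.absorb4)
  define c where "c = b - Suc a"
  have c: "c < length us" "b = Suc (a + c)" using ab xs by (auto simp: c_def)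
  obtain bs y cs where us: "us = bs @ y # cs" "length bs = c"
    using c id_take_nth_drop[of c us] by (metis length_take min.absorb4)
  have p: "transpose a b permutes {..<length xs}" using ab by (intro permutes_swap_id) auto
  have "permute_list (transpose a b) xs = as @ y # bs @ x # cs"
  proof (rule nth_equalityI)
    fix i assume "i < length (permute_list (transpose a b) xs)"
    then show "permute_list (transpose a b) xs ! i = (as @ y # bs @ x # cs) ! i"
      by (subst permute_list_nth[OF p], simp)
         (auto simp: xs(1) xs(2)[symmetric] us(1) us(2)[symmetric] c(2) nth_append transpose_def nth_Cons
           split: nat.splits)
  qed (simp add: xs us)
  then show ?thesis
    using swap_alt_move[OF swap_alt_append[OF f, of as], of y bs "x # cs"]
      swap_alt_move[OF swap_alt_append[OF f, of as], of x bs "y # cs"]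
      swap_altD[OF f, of "as @ bs" x y cs] by (simp add: xs us)
qed

text \<open>By induction over the transpositions that compose \<open>p\<close>. This recovers the
  condition in the definition of oriented chains.\<close>

lemma swap_alt_permute:
  assumes f: "swap_alt f" and "p permutes {..<length xs}"
  shows "f (permute_list p xs) = of_int (sign p) * f xs"
proof -
  have "\<forall>xs. length xs = n \<longrightarrow> f (permute_list p xs) = of_int (sign p) * f xs"
    if "p permutes {..<n}" for n
    using that
  proof (induction rule: permutes_induct[consumes 1, case_names fin id swap])
    case (swap a b p)
    have t: "f (permute_list (transpose a b) xs) = - f xs" if "length xs = n" for xs
      using swap_alt_transpose_less[OF f, of a b xs] swap_alt_transpose_less[OF f, of b a xs]
        swap.hyps that by (cases "a < b") (simp_all add: transpose_commute[of b a])
    have s: "sign (transpose a b \<circ> p) = - sign p"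
      using swap.hyps by (subst sign_compose) (auto simp: sign_swap_id permutation_swap_id
        intro: permutes_imp_permutation[of "{..<n}"])
    show ?case
    proof (intro allI impI)
      fix xs :: "'a list" assume xs: "length xs = n"
      have "permute_list (transpose a b \<circ> p) xs = permute_list p (permute_list (transpose a b) xs)"
        using swap.hyps xs by (intro permute_list_compose) simp
      then show "f (permute_list (transpose a b \<circ> p) xs) = of_int (sign (transpose a b \<circ> p)) * f xs"
        using swap.IH t[OF xs] s xs by simp
    qed
  qed auto
  with assms show ?thesis by blast
qed

lemma oriented_chain_swap_alt: "c \<in> carrier (oriented_chains X m) \<Longrightarrow> swap_alt c"
  unfolding swap_alt_def by (intro allI) (rule oriented_chain_swap)

lemma oriented_chainI:
  assumes "swap_alt c" "\<And>xs. c xs \<noteq> 0 \<Longrightarrow> length xs = m \<and> set xs \<in> X"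
  shows "c \<in> carrier (oriented_chains X m)"
  using assms swap_alt_permute[OF assms(1)] swap_alt_not_distinct[OF assms(1)]
  by (auto simp: oriented_chains_def)

text \<open>Repeated letters are allowed, so the functions on these words are all tensors of degree
  \<open>m\<close> over \<open>V\<close>. Sums over words count every simplex once for each ordering
  of its vertices.\<close>

definition words :: "'a set \<Rightarrow> nat \<Rightarrow> 'a list set" where
  "words V m = {xs. set xs \<subseteq> V \<and> length xs = m}"

lemma finite_words: "finite V \<Longrightarrow> finite (words V m)"
  using finite_lists_length_eq by (simp add: words_def)

lemma words_0: "words V 0 = {[]}" by (auto simp: words_def)

lemma sum_words_Suc: "(\<Sum>xs\<in>words V (Suc m). f xs) = (\<Sum>v\<in>V. \<Sum>xs\<in>words V m. f (v # xs))"
proof -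
  have "words V (Suc m) = (\<lambda>(v, xs). v # xs) ` (V \<times> words V m)"
    by (auto simp: words_def length_Suc_conv image_iff)
  then have "(\<Sum>xs\<in>words V (Suc m). f xs) = (\<Sum>p\<in>V \<times> words V m. f (fst p # snd p))"
    by (simp add: sum.reindex inj_on_def case_prod_beta)
  then show ?thesis by (simp add: sum.cartesian_product case_prod_beta)
qed

text \<open>For alternating \<open>c\<close> this is, up to normalization, the exterior product with
  \<open>s\<close>. The minus sign accounts for the shift by one of all positions behind
  \<open>v\<close>.\<close>

fun coboundary :: "('a \<Rightarrow> real) \<Rightarrow> ('a list \<Rightarrow> real) \<Rightarrow> 'a list \<Rightarrow> real" where
  "coboundary s c [] = 0"
| "coboundary s c (v # xs) = s v * c xs - coboundary s (\<lambda>ys. c (v # ys)) xs"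

lemma coboundary_uminus: "coboundary s (\<lambda>xs. - c xs) xs = - coboundary s c xs"
  by (induction xs arbitrary: c) simp_all

lemma coboundary_swap_alt:
  assumes "swap_alt c"
  shows "swap_alt (coboundary s c)"
proof -
  have "coboundary s c (as @ y # x # bs) = - coboundary s c (as @ x # y # bs)" for as x y bs
    using assms
  proof (induction as arbitrary: c)
    case Nil
    have "(\<lambda>ys. c (y # x # ys)) = (\<lambda>ys. - c (x # y # ys))"
      using swap_altD[OF Nil, of "[]" y x] by auto
    then have "coboundary s (\<lambda>ys. c (y # x # ys)) bs = - coboundary s (\<lambda>ys. c (x # y # ys)) bs"
      by (simp only: coboundary_uminus)
    then show ?case by simp
  next
    case (Cons a as)
    show ?case using Cons.IH[OF swap_alt_Cons[OF Cons.prems]] swap_altD[OF Cons.prems, of as y x bs] by simp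
  qed
  then show ?thesis unfolding swap_alt_def by blast
qed

lemma coboundary_conv_sum:
  "coboundary s c xs = (\<Sum>i<length xs. (-1) ^ i * (s (xs ! i) * c (take i xs @ drop (Suc i) xs)))"
proof (induction xs arbitrary: c)
  case (Cons v xs)
  show ?case
    by (simp add: Cons sum.lessThan_Suc_shift sum_negf del: sum.lessThan_Suc)
qed simp

text \<open>Deleting an entry of \<open>xs\<close> leaves \<open>v\<close> in front; moving
  \<open>v\<close> into the gap cancels the alternating sign and makes the term a
  substitution.\<close>

lemma coboundary_Cons_alt:
  assumes "swap_alt c"
  shows "coboundary s c (v # xs) = s v * c xs - (\<Sum>i<length xs. s (xs ! i) * c (xs[i := v]))"
proof -
  have "(-1) ^ i * (s (xs ! i) * c (v # take i xs @ drop (Suc i) xs)) = s (xs ! i) * c (xs[i := v])"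
    if "i < length xs" for i
    using swap_alt_update[OF assms that] by simp
  then show ?thesis
    unfolding coboundary.simps coboundary_conv_sum[of s "\<lambda>ys. c (v # ys)"]
    by (intro arg_cong2[of _ _ _ _ minus] sum.cong) auto
qed

text \<open>The adjoint is contraction with \<open>s\<close>. The factor \<open>Suc m\<close>
  appears because a simplex has that many times more orderings than its facets. In the induction the
  leading term of the coboundary gives one copy of the sum, and the induction hypothesis gives the
  others after one swap in \<open>d\<close>.\<close>

lemma coboundary_adjoint:
  assumes "swap_alt d"
  shows "(\<Sum>zs\<in>words V (Suc m). coboundary s c zs * d zs) =
    real (Suc m) * (\<Sum>xs\<in>words V m. c xs * (\<Sum>v\<in>V. s v * d (v # xs)))"
  using assms
proof (induction m arbitrary: c d)
  case 0
  show ?case by (simp add: sum_words_Suc words_0 sum_distrib_left mult_ac)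
next
  case (Suc m)
  let ?R = "\<Sum>u\<in>V. \<Sum>v\<in>V. \<Sum>ys\<in>words V m. c (v # ys) * (s u * d (u # v # ys))"
  have R: "(\<Sum>xs\<in>words V (Suc m). c xs * (\<Sum>v\<in>V. s v * d (v # xs))) = ?R"
  proof -
    have "(\<Sum>xs\<in>words V (Suc m). c xs * (\<Sum>v\<in>V. s v * d (v # xs)))
        = (\<Sum>v\<in>V. \<Sum>u\<in>V. \<Sum>ys\<in>words V m. c (v # ys) * (s u * d (u # v # ys)))"
      unfolding sum_words_Suc sum_distrib_left by (rule sum.cong[OF refl], rule sum.swap)
    also have "\<dots> = ?R" by (rule sum.swap)
    finally show ?thesis .
  qed
  have IH: "(\<Sum>zs\<in>words V (Suc m). coboundary s (\<lambda>ys. c (v # ys)) zs * d (v # zs)) =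
      real (Suc m) * (\<Sum>u\<in>V. \<Sum>ys\<in>words V m. - (c (v # ys) * (s u * d (u # v # ys))))" for v
  proof -
    have sw: "d (v # u # ys) = - d (u # v # ys)" for u ys
      using swap_altD[OF Suc.prems, of "[]" v u] by simp
    show ?thesis
      unfolding Suc.IH[OF swap_alt_Cons[OF Suc.prems]] sum_distrib_left
      by (subst sum.swap) (simp add: sw)
  qed
  have "(\<Sum>zs\<in>words V (Suc (Suc m)). coboundary s c zs * d zs) =
     (\<Sum>v\<in>V. \<Sum>xs\<in>words V (Suc m). s v * c xs * d (v # xs)) -
     (\<Sum>v\<in>V. \<Sum>zs\<in>words V (Suc m). coboundary s (\<lambda>ys. c (v # ys)) zs * d (v # zs))"
    by (subst sum_words_Suc) (simp add: left_diff_distrib sum_subtractf)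
  also have "(\<Sum>v\<in>V. \<Sum>xs\<in>words V (Suc m). s v * c xs * d (v # xs)) = ?R"
    unfolding sum_words_Suc by (simp add: mult_ac)
  also have "(\<Sum>v\<in>V. \<Sum>zs\<in>words V (Suc m). coboundary s (\<lambda>ys. c (v # ys)) zs * d (v # zs)) =
      - (real (Suc m) * ?R)"
    unfolding IH sum_negf by (simp add: sum_distrib_left[symmetric] sum_negf) (subst sum.swap, simp)
  finally show ?case unfolding R by (simp add: algebra_simps)
qed

section \<open>Change of basis for tensors\<close>

text \<open>The transpose of \<open>Q\<close> acting on every slot: if the columns of
  \<open>Q\<close> form an orthonormal basis, these are the coordinates of \<open>c\<close> in the
  induced basis of tensors.\<close>

fun tensor_transform :: "'a set \<Rightarrow> ('a \<Rightarrow> 'i \<Rightarrow> real) \<Rightarrow> ('a list \<Rightarrow> real) \<Rightarrow> 'i list \<Rightarrow> real" where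
  "tensor_transform V Q c [] = c []"
| "tensor_transform V Q c (i # is) = (\<Sum>v\<in>V. Q v i * tensor_transform V Q (\<lambda>xs. c (v # xs)) is)"

lemma tensor_transform_uminus: "tensor_transform V Q (\<lambda>xs. - c xs) is = - tensor_transform V Q c is"
  by (induction "is" arbitrary: c) (simp_all add: sum_negf)

lemma tensor_transform_conv_sum:
  "tensor_transform V Q c is = (\<Sum>xs\<in>words V (length is). prod_list (map2 Q xs is) * c xs)"
  by (induction "is" arbitrary: c) (simp_all add: words_0 sum_words_Suc sum_distrib_left mult.assoc)

text \<open>The same \<open>Q\<close> acts on all slots, so the transform commutes with exchanging
  two of them.\<close>

lemma tensor_transform_swap_alt:
  assumes "swap_alt c"
  shows "swap_alt (tensor_transform V Q c)"
proof -
  have "tensor_transform V Q c (as @ y # x # bs) = - tensor_transform V Q c (as @ x # y # bs)" for as x y bs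
    using assms
  proof (induction as arbitrary: c)
    case Nil
    have "(\<lambda>xs. c (u # v # xs)) = (\<lambda>xs. - c (v # u # xs))" for u v
      using swap_altD[OF Nil, of "[]" u v] by auto
    note sw = this
    have *: "tensor_transform V Q (\<lambda>xs. c (u # v # xs)) bs = - tensor_transform V Q (\<lambda>xs. c (v # u # xs)) bs" for u v
      unfolding sw[of u v] by (rule tensor_transform_uminus)
    have "tensor_transform V Q c (y # x # bs) =
        (\<Sum>u\<in>V. \<Sum>v\<in>V. Q u y * (Q v x * tensor_transform V Q (\<lambda>xs. c (u # v # xs)) bs))"
      by (simp add: sum_distrib_left)
    also have "\<dots> = (\<Sum>v\<in>V. \<Sum>u\<in>V. Q u y * (Q v x * - tensor_transform V Q (\<lambda>xs. c (v # u # xs)) bs))"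
      by (subst sum.swap) (intro sum.cong refl arg_cong2[of _ _ _ _ "(*)"] *)
    also have "\<dots> = - tensor_transform V Q c (x # y # bs)"
      by (simp add: sum_distrib_left sum_negf mult_ac)
    finally show ?case by simp
  next
    case (Cons a as)
    show ?case using Cons.IH[OF swap_alt_Cons[OF Cons.prems]] by (simp add: sum_negf)
  qed
  then show ?thesis unfolding swap_alt_def by blast
qed

text \<open>The sum over all slots of \<open>S\<close> acting on that slot and the identity acting
  on the others.\<close>

definition tensor_derivation :: "'a set \<Rightarrow> ('a \<Rightarrow> 'a \<Rightarrow> real) \<Rightarrow> ('a list \<Rightarrow> real) \<Rightarrow> 'a list \<Rightarrow> real" where
  "tensor_derivation V S c xs = (\<Sum>j<length xs. \<Sum>u\<in>V. S (xs ! j) u * c (xs[j := u]))"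

lemma tensor_derivation_Cons:
  "tensor_derivation V S c (v # xs) =
     (\<Sum>u\<in>V. S v u * c (u # xs)) + tensor_derivation V S (\<lambda>ys. c (v # ys)) xs"
  by (simp add: tensor_derivation_def sum.lessThan_Suc_shift del: sum.lessThan_Suc)

text \<open>The coefficients on the right are the entries of \<open>Q diag(\<mu>) Q^T\<close>; the
  cases of interest are \<open>\<mu> = 1\<close> (identity) and \<open>\<mu> = l\<close> (the matrix
  \<open>S\<close>).\<close>

lemma quadratic_expand:
  fixes Q :: "'a \<Rightarrow> 'i \<Rightarrow> real"
  shows "(\<Sum>i\<in>I. \<mu> i * (\<Sum>u\<in>V. Q u i * a u) * (\<Sum>v\<in>V. Q v i * b v)) =
    (\<Sum>u\<in>V. \<Sum>v\<in>V. (\<Sum>i\<in>I. \<mu> i * Q u i * Q v i) * (a u * b v))"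
proof -
  have "(\<Sum>i\<in>I. \<mu> i * (\<Sum>u\<in>V. Q u i * a u) * (\<Sum>v\<in>V. Q v i * b v)) =
      (\<Sum>i\<in>I. \<Sum>u\<in>V. \<Sum>v\<in>V. \<mu> i * Q u i * Q v i * (a u * b v))"
    by (simp add: sum_product sum_distrib_left mult_ac)
  also have "\<dots> = (\<Sum>u\<in>V. \<Sum>i\<in>I. \<Sum>v\<in>V. \<mu> i * Q u i * Q v i * (a u * b v))"
    by (rule sum.swap)
  also have "\<dots> = (\<Sum>u\<in>V. \<Sum>v\<in>V. \<Sum>i\<in>I. \<mu> i * Q u i * Q v i * (a u * b v))"
    by (intro sum.cong refl sum.swap)
  finally show ?thesis by (simp add: sum_distrib_right)
qed

lemma quadratic_orthonormal:
  assumes "finite V" "\<And>u v. u \<in> V \<Longrightarrow> v \<in> V \<Longrightarrow> (\<Sum>i\<in>I. Q u i * Q v i) = (if u = v then 1 else (0::real))"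
  shows "(\<Sum>i\<in>I. (\<Sum>u\<in>V. Q u i * a u) * (\<Sum>v\<in>V. Q v i * b v)) = (\<Sum>u\<in>V. a u * b u)"
proof -
  have "(\<Sum>i\<in>I. (\<Sum>u\<in>V. Q u i * a u) * (\<Sum>v\<in>V. Q v i * b v)) =
      (\<Sum>u\<in>V. \<Sum>v\<in>V. (if u = v then 1 else 0) * (a u * b v))"
    using quadratic_expand[where \<mu> = "\<lambda>_. 1" and I = I and V = V and Q = Q and a = a and b = b] assms(2) by simp
  also have "\<dots> = (\<Sum>u\<in>V. \<Sum>v\<in>V. if u = v then a u * b v else 0)"
    by (intro sum.cong refl) simp
  also have "\<dots> = (\<Sum>u\<in>V. a u * b u)" using assms(1) by simp
  finally show ?thesis .
qed

text \<open>Orthonormal rows of \<open>Q\<close> preserve inner products in the first slot, and the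
  induction treats the other slots.\<close>

lemma tensor_parseval:
  assumes "finite V" "\<And>u v. u \<in> V \<Longrightarrow> v \<in> V \<Longrightarrow> (\<Sum>i\<in>I. Q u i * Q v i) = (if u = v then 1 else (0::real))"
  shows "(\<Sum>is\<in>words I m. tensor_transform V Q c is * tensor_transform V Q d is) = (\<Sum>xs\<in>words V m. c xs * d xs)"
proof (induction m arbitrary: c d)
  case (Suc m)
  have "(\<Sum>is\<in>words I (Suc m). tensor_transform V Q c is * tensor_transform V Q d is) =
     (\<Sum>is\<in>words I m. \<Sum>i\<in>I. (\<Sum>u\<in>V. Q u i * tensor_transform V Q (\<lambda>xs. c (u # xs)) is) *
        (\<Sum>u\<in>V. Q u i * tensor_transform V Q (\<lambda>xs. d (u # xs)) is))"
    unfolding sum_words_Suc by (subst sum.swap) simp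
  also have "\<dots> = (\<Sum>is\<in>words I m. \<Sum>u\<in>V. tensor_transform V Q (\<lambda>xs. c (u # xs)) is * tensor_transform V Q (\<lambda>xs. d (u # xs)) is)"
    by (intro sum.cong refl quadratic_orthonormal assms)
  also have "\<dots> = (\<Sum>xs\<in>words V (Suc m). c xs * d xs)"
    unfolding sum_words_Suc by (subst sum.swap) (simp add: Suc)
  finally show ?case .
qed (simp add: words_0)

text \<open>In an orthonormal eigenbasis of \<open>S\<close> the derivation multiplies the
  coordinate at \<open>is\<close> by the sum of the eigenvalues listed by \<open>is\<close>; this is
  its bilinear form.\<close>

lemma tensor_derivation_diagonal:
  assumes V: "finite V" "\<And>u v. u \<in> V \<Longrightarrow> v \<in> V \<Longrightarrow> (\<Sum>i\<in>I. Q u i * Q v i) = (if u = v then 1 else (0::real))"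
    and S: "\<And>u v. u \<in> V \<Longrightarrow> v \<in> V \<Longrightarrow> (\<Sum>i\<in>I. l i * Q u i * Q v i) = S u v"
  shows "(\<Sum>is\<in>words I m. sum_list (map l is) * (tensor_transform V Q c is * tensor_transform V Q d is)) =
    (\<Sum>xs\<in>words V m. c xs * tensor_derivation V S d xs)"
proof (induction m arbitrary: c d)
  case 0
  show ?case by (simp add: words_0 tensor_derivation_def)
next
  case (Suc m)
  let ?C = "\<lambda>u. tensor_transform V Q (\<lambda>xs. c (u # xs))"
  let ?D = "\<lambda>u. tensor_transform V Q (\<lambda>xs. d (u # xs))"
  have "(\<Sum>is\<in>words I (Suc m). sum_list (map l is) * (tensor_transform V Q c is * tensor_transform V Q d is)) =
     (\<Sum>is\<in>words I m. \<Sum>i\<in>I. (l i + sum_list (map l is)) * ((\<Sum>u\<in>V. Q u i * ?C u is) * (\<Sum>u\<in>V. Q u i * ?D u is)))"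
    unfolding sum_words_Suc by (subst sum.swap) simp
  also have "\<dots> = (\<Sum>is\<in>words I m. (\<Sum>i\<in>I. l i * (\<Sum>u\<in>V. Q u i * ?C u is) * (\<Sum>u\<in>V. Q u i * ?D u is)) +
        sum_list (map l is) * (\<Sum>i\<in>I. (\<Sum>u\<in>V. Q u i * ?C u is) * (\<Sum>u\<in>V. Q u i * ?D u is)))"
  proof -
    have "(\<Sum>i\<in>I. (l i + t) * (A i * B i)) = (\<Sum>i\<in>I. l i * A i * B i) + t * (\<Sum>i\<in>I. A i * B i)" for t A B
      by (simp add: distrib_right sum.distrib sum_distrib_left mult.assoc)
    then show ?thesis by (simp only:)
  qed
  also have "\<dots> = (\<Sum>is\<in>words I m. (\<Sum>u\<in>V. \<Sum>v\<in>V. S u v * (?C u is * ?D v is)) +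
        sum_list (map l is) * (\<Sum>u\<in>V. ?C u is * ?D u is))"
  proof -
    have "(\<Sum>i\<in>I. (\<Sum>u\<in>V. Q u i * a u) * (\<Sum>v\<in>V. Q v i * b v)) = (\<Sum>u\<in>V. a u * b u)" for a b
      by (rule quadratic_orthonormal[OF V])
    then show ?thesis unfolding quadratic_expand by (simp add: S)
  qed
  also have "\<dots> = (\<Sum>u\<in>V. \<Sum>v\<in>V. S u v * (\<Sum>is\<in>words I m. ?C u is * ?D v is)) +
        (\<Sum>u\<in>V. \<Sum>is\<in>words I m. sum_list (map l is) * (?C u is * ?D u is))"
  proof -
    have "(\<Sum>is\<in>words I m. \<Sum>u\<in>V. \<Sum>v\<in>V. S u v * (?C u is * ?D v is)) =
        (\<Sum>u\<in>V. \<Sum>is\<in>words I m. \<Sum>v\<in>V. S u v * (?C u is * ?D v is))" by (rule sum.swap)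
    also have "\<dots> = (\<Sum>u\<in>V. \<Sum>v\<in>V. \<Sum>is\<in>words I m. S u v * (?C u is * ?D v is))"
      by (intro sum.cong refl sum.swap)
    finally have 1: "(\<Sum>is\<in>words I m. \<Sum>u\<in>V. \<Sum>v\<in>V. S u v * (?C u is * ?D v is)) =
        (\<Sum>u\<in>V. \<Sum>v\<in>V. S u v * (\<Sum>is\<in>words I m. ?C u is * ?D v is))"
      by (simp only: sum_distrib_left)
    have 2: "(\<Sum>is\<in>words I m. sum_list (map l is) * (\<Sum>u\<in>V. ?C u is * ?D u is)) =
        (\<Sum>u\<in>V. \<Sum>is\<in>words I m. sum_list (map l is) * (?C u is * ?D u is))"
      unfolding sum_distrib_left by (rule sum.swap)
    show ?thesis unfolding sum.distrib 1 2 ..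
  qed
  \<comment> \<open>The terms with \<open>S u v\<close> belong to the first slot and need only
    Parseval for the rest; the eigenvalue sums of the remaining slots are covered by the induction
    hypothesis.\<close>
  also have "\<dots> = (\<Sum>u\<in>V. \<Sum>v\<in>V. S u v * (\<Sum>xs\<in>words V m. c (u # xs) * d (v # xs))) +
        (\<Sum>u\<in>V. \<Sum>xs\<in>words V m. c (u # xs) * tensor_derivation V S (\<lambda>ys. d (u # ys)) xs)"
  proof -
    have "(\<Sum>is\<in>words I m. tensor_transform V Q a is * tensor_transform V Q b is) = (\<Sum>xs\<in>words V m. a xs * b xs)" for a b
      by (rule tensor_parseval[OF V])
    then show ?thesis unfolding Suc by simp
  qed
  also have "\<dots> = (\<Sum>xs\<in>words V (Suc m). c xs * tensor_derivation V S d xs)"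
  proof -
    have "(\<Sum>u\<in>V. \<Sum>v\<in>V. S u v * (\<Sum>xs\<in>words V m. c (u # xs) * d (v # xs))) =
       (\<Sum>u\<in>V. \<Sum>xs\<in>words V m. c (u # xs) * (\<Sum>v\<in>V. S u v * d (v # xs)))"
      unfolding sum_distrib_left by (rule sum.cong[OF refl], subst sum.swap) (simp add: mult_ac)
    then show ?thesis
      unfolding sum_words_Suc tensor_derivation_Cons by (simp add: distrib_left sum.distrib)
  qed
  finally show ?case .
qed

section \<open>Diagonalization of the symmetrized Laplacian\<close>

text \<open>Let \<open>e_0\<close> be the first unit vector. As \<open>v\<close> and
  \<open>e_0\<close> have the same length, the reflection along \<open>u = v - e_0\<close> exchanges
  them.\<close>

lemma householder_reflection:
  fixes v :: "real vec"
  assumes v: "v \<in> carrier_vec n" "v \<bullet> v = 1" and n: "0 < n"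
  shows "\<exists>H\<in>carrier_mat n n. H\<^sup>T = H \<and> H * H = 1\<^sub>m n \<and> col H 0 = v"
proof -
  define u where "u i = v $ i - (if i = 0 then 1 else 0)" for i
  define q where "q = (\<Sum>k<n. (u k)\<^sup>2)"
  \<comment> \<open>If \<open>v\<close> is the first unit vector then \<open>q = 0\<close>, and \<open>2 / q = 0\<close> makes \<open>H\<close> the identity.\<close>
  define H where "H = mat n n (\<lambda>(i, j). (if i = j then 1 else 0) - 2 / q * u i * u j)"
  have vv: "(\<Sum>k<n. (v $ k)\<^sup>2) = 1"
    using v by (simp add: scalar_prod_def power2_eq_square atLeast0LessThan)
  have "q = (\<Sum>k<n. (v $ k)\<^sup>2 + (if k = 0 then 1 - 2 * v $ 0 else 0))"
    unfolding q_def u_def by (intro sum.cong) (auto simp: power2_eq_square algebra_simps)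
  \<comment> \<open>For unit vectors the squared length of \<open>v - e_0\<close> is
    \<open>2 - 2 * v $ 0\<close>.\<close>
  then have q: "q = - 2 * u 0" using n vv by (simp add: sum.distrib u_def)
  have q0: "u k = 0" if "q = 0" "k < n" for k
    using that by (simp add: q_def sum_nonneg_eq_0_iff)
  have [simp]: "H \<in> carrier_mat n n" by (simp add: H_def)
  have "H * H = 1\<^sub>m n"
  proof (rule eq_matI)
    fix i j assume ij: "i < dim_row (1\<^sub>m n :: real mat)" "j < dim_col (1\<^sub>m n :: real mat)"
    have "(H * H) $$ (i, j) = (\<Sum>k<n. ((if i = k then 1 else 0) - 2 / q * u i * u k) * ((if k = j then 1 else 0) - 2 / q * u k * u j))"
      using ij by (simp add: H_def scalar_prod_def atLeast0LessThan)
    also have "\<dots> = (\<Sum>k<n. (if k = i then (if i = j then 1 else 0) - 2 / q * u i * u j else 0)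
        - (if k = j then 2 / q * u i * u j else 0) + (2 / q)\<^sup>2 * u i * u j * (u k)\<^sup>2)"
      by (intro sum.cong refl) (auto simp: algebra_simps power2_eq_square)
    also have "\<dots> = (if i = j then 1 else 0) - 4 / q * u i * u j + (2 / q)\<^sup>2 * u i * u j * q"
      using ij by (simp add: sum.distrib sum_subtractf q_def sum_distrib_left[symmetric])
    also have "\<dots> = (if i = j then 1 else 0)" by (simp add: power2_eq_square)
    finally show "(H * H) $$ (i, j) = 1\<^sub>m n $$ (i, j)" using ij by simp
  qed (simp_all add: H_def)
  moreover have "H\<^sup>T = H" by (rule eq_matI) (auto simp: H_def)
  moreover have "col H 0 = v"
  proof (rule eq_vecI)
    fix i assume i: "i < dim_vec v"
    then have "col H 0 $ i = (if i = 0 then 1 else 0) - 2 / q * u i * u 0" using v n by (simp add: H_def)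
    also have "\<dots> = v $ i"
    proof (cases "q = 0")
      case True then show ?thesis using q0[of i] i v by (simp add: u_def split: if_splits)
    next
      case False
      then have "2 / q * u i * u 0 = - u i" using q by (simp add: field_simps)
      then show ?thesis by (simp add: u_def)
    qed
    finally show "col H 0 $ i = v $ i" .
  qed (use v in \<open>simp add: H_def\<close>)
  ultimately show ?thesis by (intro bexI[of _ H]) simp_all
qed

text \<open>The spectral theorem by deflation, with the eigenvalues in the order of
  \<open>es\<close>. Conjugation by a reflection moves a unit eigenvector for the head to the first
  coordinate; by symmetry a block of size one splits off, and the other block keeps the remaining
  linear factors.\<close>

lemma symmetric_mat_diagonalization:
  fixes A :: "real mat"
  assumes "A \<in> carrier_mat n n" "A\<^sup>T = A" "char_poly A = (\<Prod>e\<leftarrow>es. [:- e, 1:])"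
  shows "\<exists>P\<in>carrier_mat n n. P * P\<^sup>T = 1\<^sub>m n \<and> A = P * mat_diag n ((!) es) * P\<^sup>T"
  using assms
proof (induction es arbitrary: n A)
  case Nil
  then have "n = 0" using degree_monic_char_poly[of A n] by simp
  then show ?case using Nil by (intro bexI[of _ "1\<^sub>m 0"]) auto
next
  case (Cons e es n A)
  note A = Cons.prems(1)
  have mon: "monic (\<Prod>e\<leftarrow>es. [:- e, 1:])" by (rule monic_prod_list) auto
  have "degree (char_poly A) = Suc (degree (\<Prod>e\<leftarrow>es. [:- e, 1:]))"
    unfolding Cons.prems(3) list.simps(9) prod_list.Cons by (subst degree_mult_eq) (use mon in auto)
  with degree_monic_char_poly[OF A] obtain m where n: "n = Suc m" by (cases n) auto
  have "eigenvalue A e"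
    unfolding eigenvalue_root_char_poly[OF A] Cons.prems(3) by simp
  then obtain u where u: "u \<in> carrier_vec n" "u \<noteq> 0\<^sub>v n" "A *\<^sub>v u = e \<cdot>\<^sub>v u"
    using A by (auto simp: eigenvalue_def eigenvector_def)
  define v where "v = (1 / sqrt (u \<bullet> u)) \<cdot>\<^sub>v u"
  have uu: "u \<bullet> u > 0"
    using conjugate_square_greater_0_vec[OF u(1)] u(2) by (simp add: vec_conjugate_real)
  have v: "v \<in> carrier_vec n" "v \<bullet> v = 1" "A *\<^sub>v v = e \<cdot>\<^sub>v v"
    using u uu A by (auto simp: v_def mult_mat_vec[OF A] smult_smult_assoc mult.commute)
  obtain H where H: "H \<in> carrier_mat n n" "H\<^sup>T = H" "H * H = 1\<^sub>m n" "col H 0 = v"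
    using householder_reflection[OF v(1,2)] n by auto
  define A' where "A' = H * A * H"
  have A': "A' \<in> carrier_mat n n" using H A by (simp add: A'_def)
  have "A'\<^sup>T = H * (A * H)"
    using H A Cons.prems(2) by (simp add: A'_def transpose_mult[of _ n n _ n])
  then have A'T: "A'\<^sup>T = A'" using H A by (simp add: A'_def)
  have "col A' 0 = H *\<^sub>v (A *\<^sub>v col H 0)"
  proof -
    have HA: "H * A \<in> carrier_mat n n" using H A by simp
    have "col A' 0 = (H * A) *\<^sub>v col H 0"
      unfolding A'_def using n by (intro col_mult2[OF HA H(1)]) simp
    also have "\<dots> = H *\<^sub>v (A *\<^sub>v col H 0)"
      unfolding H(4) by (rule assoc_mult_mat_vec[OF H(1) A v(1)])
    finally show ?thesis .
  qed
  also have "\<dots> = e \<cdot>\<^sub>v (H *\<^sub>v col H 0)" using H v by (simp add: mult_mat_vec[OF H(1)])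
  also have "H *\<^sub>v col H 0 = unit_vec n 0"
    using col_mult2[OF H(1) H(1), of 0] H(3) n by simp
  finally have colA': "col A' 0 = e \<cdot>\<^sub>v unit_vec n 0" .
  define A3 where "A3 = mat m m (\<lambda>(i, j). A' $$ (Suc i, Suc j))"
  have A3: "A3 \<in> carrier_mat m m" by (simp add: A3_def)
  have A3_index: "A3 $$ (i, j) = A' $$ (Suc i, Suc j)" if "i < m" "j < m" for i j
    using that by (simp add: A3_def)
  have A'0: "A' $$ (i, 0) = (if i = 0 then e else 0)" if "i < n" for i
    using arg_cong[OF colA', of "\<lambda>x. x $ i"] that A' n by simp
  have A'0': "A' $$ (0, i) = (if i = 0 then e else 0)" if "i < n" for i
    using A'0[OF that] arg_cong[OF A'T, of "\<lambda>x. x $$ (i, 0)"] that A' n by simp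
  \<comment> \<open>Forming this block diagonal matrix commutes with products and transposition, so
    a diagonalization of \<open>A3\<close> lifts to one of \<open>A'\<close>.\<close>
  define F where "F x B = four_block_mat (mat 1 1 (\<lambda>_. x)) (0\<^sub>m 1 m) (0\<^sub>m m 1) B" for x :: real and B
  have F_index: "F x B $$ (i, j) = (if i = 0 then if j = 0 then x else 0
      else if j = 0 then 0 else B $$ (i - 1, j - 1))" if "B \<in> carrier_mat m m" "i < n" "j < n" for x B i j
    using that n by (simp add: F_def)
  have blk: "A' = F e A3"
  proof (rule eq_matI)
    fix i j assume "i < dim_row (F e A3)" "j < dim_col (F e A3)"
    then have "i < n" "j < n" using n A3 by (simp_all add: F_def)
    then show "A' $$ (i, j) = F e A3 $$ (i, j)"
      using A'0[of i] A'0'[of j] n by (cases i; cases j) (simp_all add: F_index[OF A3] A3_index)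
  qed (use A' n A3 in \<open>simp_all add: F_def\<close>)
  have A3T: "A3\<^sup>T = A3"
  proof (rule eq_matI)
    fix i j assume "i < dim_row A3" "j < dim_col A3"
    then show "A3\<^sup>T $$ (i, j) = A3 $$ (i, j)"
      using arg_cong[OF A'T, of "\<lambda>x. x $$ (Suc i, Suc j)"] A' n by (simp add: A3_def)
  qed (auto simp: A3_def)
  have "similar_mat_wit A' A H H"
    by (rule similar_mat_witI[of _ _ n]) (use H A A' A'_def in auto)
  then have "char_poly A' = char_poly A" by (intro char_poly_similar) (auto simp: similar_mat_def)
  moreover have "char_poly A' = char_poly (mat 1 1 (\<lambda>_. e)) * char_poly A3"
    unfolding blk F_def by (rule char_poly_four_block_zeros_col) (use A3 in auto)
  moreover have "char_poly (mat 1 1 (\<lambda>_. e)) = [:- e, 1:]"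
    by (simp add: char_poly_defs det_def sign_def)
  ultimately have "[:- e, 1:] * char_poly A3 = [:- e, 1:] * (\<Prod>e\<leftarrow>es. [:- e, 1:])"
    using Cons.prems(3) by (simp only: list.simps(9) prod_list.Cons)
  then have "char_poly A3 = (\<Prod>e\<leftarrow>es. [:- e, 1:])" by (simp only: mult_cancel_left) simp
  from Cons.IH[OF A3 A3T this] obtain P where P: "P \<in> carrier_mat m m" "P * P\<^sup>T = 1\<^sub>m m"
    "A3 = P * mat_diag m ((!) es) * P\<^sup>T" by blast
  define D where "D = mat_diag m ((!) es)"
  have D: "D \<in> carrier_mat m m" by (simp add: D_def)
  have F: "F x B \<in> carrier_mat n n" if "B \<in> carrier_mat m m" for x B
    using that n by (intro carrier_matI) (simp_all add: F_def)
  have FT: "(F x B)\<^sup>T = F x (B\<^sup>T)" if "B \<in> carrier_mat m m" for x B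
    unfolding F_def by (subst transpose_four_block_mat[of _ 1 1 _ m _ m]) (use that in \<open>auto intro!: arg_cong2[of _ _ _ _ "\<lambda>X Y. four_block_mat X (0\<^sub>m 1 m) (0\<^sub>m m 1) Y"]\<close>)
  have FM: "F x B * F y C = F (x * y) (B * C)" if "B \<in> carrier_mat m m" "C \<in> carrier_mat m m" for x y B C
    unfolding F_def by (subst mult_four_block_mat[of _ 1 1 _ m _ m _ _ 1 _ m]) (use that in \<open>auto intro!: arg_cong2[of _ _ _ _ "\<lambda>X Y. four_block_mat X (0\<^sub>m 1 m) (0\<^sub>m m 1) Y"] simp: scalar_prod_def\<close>)
  have F1: "F 1 (1\<^sub>m m) = 1\<^sub>m n"
    by (rule eq_matI) (auto simp: n F_def)
  have FD: "F e D = mat_diag n ((!) (e # es))"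
    by (rule eq_matI) (auto simp: n F_def D_def mat_diag_def nth_Cons split: nat.splits)
  define R where "R = H * F 1 P"
  have R: "R \<in> carrier_mat n n" using H F[OF P(1)] by (simp add: R_def)
  have mult_carr: "X * Y \<in> carrier_mat n n" if "X \<in> carrier_mat n n" "Y \<in> carrier_mat n n" for X Y :: "real mat"
    using that by simp
  have assoc: "X * Y * Z = X * (Y * Z)" if "X \<in> carrier_mat n n" "Y \<in> carrier_mat n n" "Z \<in> carrier_mat n n"
    for X Y Z :: "real mat"
    using that by (rule assoc_mult_mat)
  have PT: "P\<^sup>T \<in> carrier_mat m m" using P by simp
  have RT: "R\<^sup>T = F 1 (P\<^sup>T) * H"
    unfolding R_def using H F[OF P(1)] by (simp add: transpose_mult[of _ n n _ n] FT[OF P(1)])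
  have "R * R\<^sup>T = H * (F 1 P * F 1 (P\<^sup>T)) * H"
    unfolding RT unfolding R_def using H F[OF P(1)] F[OF PT] by (simp add: assoc mult_carr)
  then have "R * R\<^sup>T = 1\<^sub>m n" using H P by (simp add: FM[OF P(1) PT] F1)
  moreover have "R * mat_diag n ((!) (e # es)) * R\<^sup>T = A"
  proof -
    have "R * F e D * R\<^sup>T = H * (F 1 P * F e D * F 1 (P\<^sup>T)) * H"
      unfolding RT unfolding R_def using H F[OF P(1)] F[OF PT] F[OF D] by (simp add: assoc mult_carr)
    also have "F 1 P * F e D * F 1 (P\<^sup>T) = A'"
      using P D PT by (simp add: FM blk D_def[symmetric])
    also have "H * A' * H = (H * H) * A * (H * H)"
      unfolding A'_def using H(1) A by (simp add: assoc mult_carr)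
    also have "\<dots> = A" using H A by simp
    finally show ?thesis by (simp add: FD)
  qed
  ultimately show ?case using R by metis
qed

text \<open>For nonvanishing \<open>s\<close> this is the Laplacian with weights
  \<open>(s v)\<^sup>2\<close> conjugated by the diagonal matrix of \<open>s\<close>; the explicit
  formula also covers zero weights.\<close>

definition symmetric_laplacian :: "'a set set \<Rightarrow> ('a \<Rightarrow> real) \<Rightarrow> 'a \<Rightarrow> 'a \<Rightarrow> real" where
  "symmetric_laplacian E s u v =
     (if u = v then \<Sum>u'\<in>neighbours E u. (s u')\<^sup>2 else if {u, v} \<in> E then - (s u * s v) else 0)"

text \<open>Conjugation by a diagonal matrix would need all \<open>t i\<close> to be nonzero. The
  Leibniz terms can be compared in any case: a permutation enters and leaves each index that it
  moves exactly once.\<close>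

lemma char_poly_symmetrize:
  fixes A B :: "real mat" and e :: "nat \<Rightarrow> nat \<Rightarrow> real"
  assumes A: "A \<in> carrier_mat n n" and B: "B \<in> carrier_mat n n"
    and diag: "\<And>i. i < n \<Longrightarrow> A $$ (i, i) = B $$ (i, i)"
    and offA: "\<And>i j. i < n \<Longrightarrow> j < n \<Longrightarrow> i \<noteq> j \<Longrightarrow> A $$ (i, j) = e i j * (t j)\<^sup>2"
    and offB: "\<And>i j. i < n \<Longrightarrow> j < n \<Longrightarrow> i \<noteq> j \<Longrightarrow> B $$ (i, j) = e i j * (t i * t j)"
  shows "char_poly A = char_poly B"
proof -
  have *: "(\<Prod>i=0..<n. char_poly_matrix A $$ (i, p i)) = (\<Prod>i=0..<n. char_poly_matrix B $$ (i, p i))"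
    if p: "p permutes {0..<n}" for p
  proof -
    have lt: "p i < n" if "i < n" for i using permutes_in_image[OF p, of i] that by simp
    have fix_iff: "p (p i) = p i \<longleftrightarrow> p i = i" for i
      using inj_eq[OF permutes_inj[OF p], of "p i" i] .
    \<comment> \<open>As \<open>p\<close> permutes its non-fixed points, the square at \<open>p i\<close> can be traded for the product
      of the values at \<open>i\<close> and \<open>p i\<close>.\<close>
    define g where "g i = (if p i = i then 1 else [:t i:])" for i
    define d where "d i = (if p i = i then char_poly_matrix A $$ (i, i) else [:- e i (p i):])" for i
    have "(\<Prod>i=0..<n. char_poly_matrix A $$ (i, p i)) = (\<Prod>i=0..<n. d i * (g (p i) * g (p i)))"
      by (rule prod.cong[OF refl])
         (use A lt in \<open>auto simp: d_def g_def fix_iff char_poly_matrix_def offA power2_eq_square\<close>)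
    also have "\<dots> = (\<Prod>i=0..<n. d i) * ((\<Prod>i=0..<n. g (p i)) * (\<Prod>i=0..<n. g (p i)))"
      by (simp add: prod.distrib)
    also have "\<dots> = (\<Prod>i=0..<n. d i) * ((\<Prod>i=0..<n. g i) * (\<Prod>i=0..<n. g (p i)))"
      using prod.permute[OF p, of g] by (simp add: o_def)
    also have "\<dots> = (\<Prod>i=0..<n. d i * (g i * g (p i)))"
      by (simp add: prod.distrib)
    also have "\<dots> = (\<Prod>i=0..<n. char_poly_matrix B $$ (i, p i))"
      by (rule prod.cong[OF refl])
         (use A B lt in \<open>auto simp: d_def g_def fix_iff char_poly_matrix_def offB diag\<close>)
    finally show ?thesis .
  qed
  show ?thesis
    unfolding char_poly_def det_def'[OF char_poly_matrix_closed[OF A]] det_def'[OF char_poly_matrix_closed[OF B]]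
    by (rule sum.cong[OF refl]) (simp add: *)
qed

lemma char_poly_weighted_laplacian:
  assumes G: "simple_graph V E" and vs: "distinct vs" "set vs = V"
    and s: "\<And>v. v \<in> V \<Longrightarrow> (s v)\<^sup>2 = w v"
  shows "char_poly (matrix_wrt vs (weighted_laplacian E w)) = char_poly (matrix_wrt vs (symmetric_laplacian E s))"
proof -
  let ?n = "length vs"
  have nb: "neighbours E u \<subseteq> V" for u
    using G by (auto simp: simple_graph_def neighbours_def)
  have deg: "(\<Sum>u'\<in>neighbours E u. w u') = (\<Sum>u'\<in>neighbours E u. (s u')\<^sup>2)" for u
    using nb[of u] s by (intro sum.cong) auto
  show ?thesis
    by (rule char_poly_symmetrize[where n = ?n and t = "\<lambda>i. s (vs ! i)"
          and e = "\<lambda>i j. if {vs ! i, vs ! j} \<in> E then -1 else 0"])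
       (use vs s in \<open>auto simp: matrix_wrt_def weighted_laplacian_def symmetric_laplacian_def deg nth_eq_iff_index_eq\<close>)
qed

lemma ordered_eigenvalues_orthonormal_eigenbasis:
  assumes vs: "distinct vs" "set vs = V" and n: "length vs = n"
    and sym: "\<And>u v. S u v = S v u"
    and cp: "char_poly (matrix_wrt vs S) = (\<Prod>i=1..n. [:- l i, 1:])"
  shows "\<exists>Q. (\<forall>u\<in>V. \<forall>v\<in>V. (\<Sum>i=1..n. Q u i * Q v i) = (if u = v then 1 else 0)) \<and>
     (\<forall>u\<in>V. \<forall>v\<in>V. (\<Sum>i=1..n. l i * Q u i * Q v i) = S u v)"
proof -
  let ?A = "matrix_wrt vs S"
  define es where "es = map l [1..<Suc n]"
  have A: "?A \<in> carrier_mat n n" "?A\<^sup>T = ?A"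
    using n sym by (auto simp: matrix_wrt_def intro!: eq_matI)
  have "char_poly ?A = (\<Prod>e\<leftarrow>es. [:- e, 1:])"
    unfolding cp es_def
    using prod.distinct_set_conv_list[of "[1..<Suc n]" "\<lambda>i. [:- l i, 1:]"]
    by (simp only: map_map o_def set_upt distinct_upt atLeastLessThanSuc_atLeastAtMost)
  from symmetric_mat_diagonalization[OF A this] obtain P where P: "P \<in> carrier_mat n n"
    "P * P\<^sup>T = 1\<^sub>m n" "?A = P * mat_diag n ((!) es) * P\<^sup>T" by blast
  have es: "es ! i = l (Suc i)" if "i < n" for i using that by (simp add: es_def del: upt_Suc)
  have shift: "(\<Sum>i=1..n. f i) = (\<Sum>i<n. f (Suc i))" for f :: "nat \<Rightarrow> real"
    by (simp add: sum.atLeast1_atMost_eq)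
  have "\<forall>u\<in>V. \<exists>k. k < n \<and> vs ! k = u" using vs(2) n by (auto simp: in_set_conv_nth)
  then obtain ix where ix: "\<And>u. u \<in> V \<Longrightarrow> ix u < n \<and> vs ! ix u = u" by metis
  \<comment> \<open>The columns of \<open>P\<close> are numbered from 0, the eigenvalues
    \<open>l\<close> from 1.\<close>
  define Q where "Q u i = P $$ (ix u, i - 1)" for u i
  have "(\<Sum>i=1..n. Q u i * Q v i) = (if u = v then 1 else 0)" if "u \<in> V" "v \<in> V" for u v
  proof -
    have "(\<Sum>i=1..n. Q u i * Q v i) = (P * P\<^sup>T) $$ (ix u, ix v)"
      using ix[OF that(1)] ix[OF that(2)] P(1)
      unfolding shift by (simp add: Q_def scalar_prod_def atLeast0LessThan)
    also have "\<dots> = (if u = v then 1 else 0)"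
    proof -
      have "ix u = ix v \<longleftrightarrow> u = v" using ix[OF that(1)] ix[OF that(2)] by metis
      then show ?thesis unfolding P(2) using ix[OF that(1)] ix[OF that(2)] by simp
    qed
    finally show ?thesis .
  qed
  moreover have "(\<Sum>i=1..n. l i * Q u i * Q v i) = S u v" if "u \<in> V" "v \<in> V" for u v
  proof -
    have "S u v = ?A $$ (ix u, ix v)"
      using ix[OF that(1)] ix[OF that(2)] n by (simp add: matrix_wrt_def)
    also have "\<dots> = (\<Sum>i<n. P $$ (ix u, i) * es ! i * P $$ (ix v, i))"
      unfolding P(3) unfolding mat_diag_mult_right[OF P(1)] using ix[OF that(1)] ix[OF that(2)] P(1)
      by (simp add: scalar_prod_def atLeast0LessThan)
    also have "\<dots> = (\<Sum>i=1..n. l i * Q u i * Q v i)"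
      unfolding shift by (simp add: Q_def es mult_ac)
    finally show ?thesis ..
  qed
  ultimately show ?thesis by blast
qed

lemma symmetric_laplacian_sym: "symmetric_laplacian E s u v = symmetric_laplacian E s v u"
  by (simp add: symmetric_laplacian_def insert_commute mult.commute)

section \<open>Harmonic chains\<close>

text \<open>Here \<open>m\<close> counts vertices, so \<open>k\<close>-chains have
  \<open>m = k + 1\<close>. The coboundary has to vanish only on lists that span simplices. All
  conditions survive pointwise limits, even if weights tend to zero.\<close>

definition harmonic :: "'a set \<Rightarrow> 'a set set \<Rightarrow> ('a \<Rightarrow> real) \<Rightarrow> nat \<Rightarrow> ('a list \<Rightarrow> real) \<Rightarrow> bool" where
  "harmonic V E s m c \<longleftrightarrow> swap_alt c \<and>
     (\<forall>xs. c xs \<noteq> 0 \<longrightarrow> length xs = m \<and> set xs \<in> independence_complex V E) \<and>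
     (\<forall>xs. (\<Sum>v\<in>V. s v * c (v # xs)) = 0) \<and>
     (\<forall>zs. set zs \<in> independence_complex V E \<longrightarrow> length zs = Suc m \<longrightarrow> coboundary s c zs = 0)"

text \<open>At \<open>xs\<close> the derivation multiplies \<open>c\<close> by the weighted degrees
  of the entries of \<open>xs\<close> plus the weight of all vertices not adjacent to
  \<open>xs\<close>. Together these count every vertex at least once.\<close>

lemma harmonic_derivation_bound:
  assumes G: "simple_graph V E"
    and alt: "swap_alt c" and supp: "\<And>xs. c xs \<noteq> 0 \<Longrightarrow> set xs \<in> independence_complex V E"
    and cyc: "\<And>xs. (\<Sum>v\<in>V. s v * c (v # xs)) = 0"
    and cocyc: "\<And>zs. set zs \<in> independence_complex V E \<Longrightarrow> length zs = Suc m \<Longrightarrow> coboundary s c zs = 0"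
    and xs: "set xs \<in> independence_complex V E" "length xs = m"
  shows "(\<Sum>v\<in>V. (s v)\<^sup>2) * (c xs)\<^sup>2 \<le> c xs * tensor_derivation V (symmetric_laplacian E s) c xs"
proof -
  have V: "finite V" and nb: "neighbours E u \<subseteq> V" and loop: "{u} \<notin> E" for u
    using G by (auto simp: simple_graph_def neighbours_def)
  define N where "N = {v \<in> V. \<exists>x\<in>set xs. {x, v} \<in> E}"
  let ?deg = "\<lambda>u. \<Sum>u'\<in>neighbours E u. (s u')\<^sup>2"
  \<comment> \<open>Without a neighbour of \<open>v\<close> in \<open>xs\<close>, the list
    \<open>v # xs\<close> still spans a simplex, so the cocycle condition applies; \<open>v\<close>
    may itself occur in \<open>xs\<close>.\<close>
  have E1: "(\<Sum>i<m. s (xs ! i) * c (xs[i := v])) = s v * c xs" if v: "v \<in> V - N" for v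
  proof -
    have "set (v # xs) \<in> independence_complex V E"
      using v xs(1) loop by (auto simp: independence_complex_def N_def insert_commute)
    from cocyc[OF this] have "coboundary s c (v # xs) = 0" using xs(2) by (simp del: coboundary.simps)
    then show ?thesis using coboundary_Cons_alt[OF alt, of s v xs] xs(2) by simp
  qed
  \<comment> \<open>The cycle condition for \<open>xs\<close> without its entry \<open>i\<close>,
    with \<open>v\<close> moved into the gap.\<close>
  have E2: "(\<Sum>v\<in>V. s v * c (xs[i := v])) = 0" if i: "i < m" for i
    using i xs(2) cyc[of "take i xs @ drop (Suc i) xs"]
    by (simp add: swap_alt_update[OF alt] mult.left_commute[of _ "(-1) ^ i"] sum_distrib_left[symmetric])
  \<comment> \<open>The neighbour of \<open>v\<close> in \<open>xs\<close> is not the replaced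
    entry, so the new list contains an edge.\<close>
  have E3: "c (xs[i := v]) = 0" if v: "v \<in> N" and i: "i < m" and ne: "{xs ! i, v} \<notin> E" for i v
  proof (rule ccontr)
    assume "c (xs[i := v]) \<noteq> 0"
    then have X: "set (xs[i := v]) \<in> independence_complex V E" by (rule supp)
    obtain j where j: "j < m" "{xs ! j, v} \<in> E"
      using v xs(2) by (auto simp: N_def in_set_conv_nth)
    with ne have "j \<noteq> i" by auto
    then have "xs ! j \<in> set (xs[i := v])" "v \<in> set (xs[i := v])"
      using i j xs(2) by (auto simp: in_set_conv_nth intro: exI[of _ j] exI[of _ i])
    with X j show False by (auto simp: independence_complex_def)
  qed
  have Nsub: "N \<subseteq> V" by (auto simp: N_def)
  let ?T = "\<Sum>v\<in>N. s v * (\<Sum>i<m. s (xs ! i) * c (xs[i := v]))"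
  \<comment> \<open>The relations \<open>E2\<close> are added with weights
    \<open>s (xs ! i)\<close>. The part over \<open>V - N\<close> is evaluated by \<open>E1\<close>;
    the part \<open>?T\<close> over \<open>N\<close> is the negative of the off-diagonal part of the
    derivation.\<close>
  have "0 = (\<Sum>i<m. s (xs ! i) * (\<Sum>v\<in>V. s v * c (xs[i := v])))" by (simp add: E2)
  also have "\<dots> = (\<Sum>v\<in>V. s v * (\<Sum>i<m. s (xs ! i) * c (xs[i := v])))"
    unfolding sum_distrib_left by (subst sum.swap) (simp add: mult_ac)
  also have "\<dots> = (\<Sum>v\<in>V - N. s v * (\<Sum>i<m. s (xs ! i) * c (xs[i := v]))) + ?T"
    using V Nsub by (simp add: sum.subset_diff)
  also have "(\<Sum>v\<in>V - N. s v * (\<Sum>i<m. s (xs ! i) * c (xs[i := v]))) = (\<Sum>v\<in>V - N. (s v)\<^sup>2) * c xs"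
    by (simp add: E1 sum_distrib_right power2_eq_square mult.assoc)
  finally have T: "- ?T = (\<Sum>v\<in>V - N. (s v)\<^sup>2) * c xs" by simp
  have "(\<Sum>u\<in>V. symmetric_laplacian E s (xs ! i) u * c (xs[i := u])) =
      ?deg (xs ! i) * c xs - (\<Sum>v\<in>N. s v * (s (xs ! i) * c (xs[i := v])))" if i: "i < m" for i
  proof -
    let ?x = "xs ! i"
    have x: "?x \<in> V" "?x \<in> set xs" using xs i by (auto simp: independence_complex_def)
    have sub: "neighbours E ?x \<subseteq> N" using x nb by (auto simp: N_def neighbours_def)
    have nx: "?x \<notin> neighbours E ?x" using loop by (simp add: neighbours_def)
    have "(\<Sum>u\<in>V. symmetric_laplacian E s ?x u * c (xs[i := u])) =
        ?deg ?x * c (xs[i := ?x]) + (\<Sum>u\<in>V - {?x}. symmetric_laplacian E s ?x u * c (xs[i := u]))"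
      by (subst sum.remove[OF V x(1)]) (simp add: symmetric_laplacian_def)
    also have "(\<Sum>u\<in>V - {?x}. symmetric_laplacian E s ?x u * c (xs[i := u])) =
        (\<Sum>u\<in>neighbours E ?x. - (s u * (s ?x * c (xs[i := u]))))"
      by (rule sum.mono_neutral_cong_right)
         (use V nb nx in \<open>auto simp: symmetric_laplacian_def neighbours_def\<close>)
    \<comment> \<open>By \<open>E3\<close> the vertices of \<open>N\<close> that are not adjacent to
      \<open>?x\<close> contribute nothing.\<close>
    also have "\<dots> = - (\<Sum>u\<in>N. s u * (s ?x * c (xs[i := u])))"
      unfolding sum_negf
      by (intro arg_cong[of _ _ uminus] sum.mono_neutral_left)
         (use V Nsub sub E3 i in \<open>auto simp: neighbours_def intro: finite_subset\<close>)
    finally show ?thesis by simp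
  qed
  then have "tensor_derivation V (symmetric_laplacian E s) c xs =
      (\<Sum>i<m. ?deg (xs ! i)) * c xs - (\<Sum>i<m. \<Sum>v\<in>N. s v * (s (xs ! i) * c (xs[i := v])))"
    by (simp add: tensor_derivation_def xs(2) sum_subtractf sum_distrib_right)
  also have "(\<Sum>i<m. \<Sum>v\<in>N. s v * (s (xs ! i) * c (xs[i := v]))) = ?T"
    unfolding sum_distrib_left by (rule sum.swap)
  finally have D: "tensor_derivation V (symmetric_laplacian E s) c xs =
      ((\<Sum>i<m. ?deg (xs ! i)) + (\<Sum>v\<in>V - N. (s v)\<^sup>2)) * c xs" using T by (simp add: distrib_right)
  \<comment> \<open>Each vertex of \<open>N\<close> is a neighbour of some entry of
    \<open>xs\<close>, so the degrees count it.\<close>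
  have "(\<Sum>v\<in>N. (s v)\<^sup>2) \<le> (\<Sum>v\<in>N. \<Sum>i<m. if v \<in> neighbours E (xs ! i) then (s v)\<^sup>2 else 0)"
  proof (rule sum_mono)
    fix v assume "v \<in> N"
    then obtain i where i: "i < m" "v \<in> neighbours E (xs ! i)"
      using xs(2) by (auto simp: N_def in_set_conv_nth neighbours_def)
    show "(s v)\<^sup>2 \<le> (\<Sum>i<m. if v \<in> neighbours E (xs ! i) then (s v)\<^sup>2 else 0)"
      using member_le_sum[of i "{..<m}" "\<lambda>i. if v \<in> neighbours E (xs ! i) then (s v)\<^sup>2 else 0"] i by simp
  qed
  also have "\<dots> = (\<Sum>i<m. \<Sum>v\<in>N. if v \<in> neighbours E (xs ! i) then (s v)\<^sup>2 else 0)"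
    by (rule sum.swap)
  also have "\<dots> = (\<Sum>i<m. ?deg (xs ! i))"
  proof (rule sum.cong[OF refl])
    fix i assume i: "i \<in> {..<m}"
    have "neighbours E (xs ! i) \<subseteq> N" using i nb xs by (auto simp: N_def neighbours_def)
    then have "N \<inter> neighbours E (xs ! i) = neighbours E (xs ! i)" by auto
    then show "(\<Sum>v\<in>N. if v \<in> neighbours E (xs ! i) then (s v)\<^sup>2 else 0) = ?deg (xs ! i)"
      using V Nsub by (simp add: sum.inter_restrict[symmetric] finite_subset)
  qed
  finally have "(\<Sum>v\<in>V. (s v)\<^sup>2) \<le> (\<Sum>i<m. ?deg (xs ! i)) + (\<Sum>v\<in>V - N. (s v)\<^sup>2)"
    using V Nsub by (simp add: sum.subset_diff)
  then have "(\<Sum>v\<in>V. (s v)\<^sup>2) * (c xs)\<^sup>2 \<le> ((\<Sum>i<m. ?deg (xs ! i)) + (\<Sum>v\<in>V - N. (s v)\<^sup>2)) * (c xs)\<^sup>2"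
    by (rule mult_right_mono) simp
  then show ?thesis by (simp add: D power2_eq_square mult_ac)
qed

lemma coboundary_scale: "coboundary s (\<lambda>xs. r * c xs) xs = r * coboundary s c xs"
  by (induction xs arbitrary: c) (simp_all add: algebra_simps)

lemma harmonic_scale:
  assumes "harmonic V E s m c"
  shows "harmonic V E s m (\<lambda>xs. r * c xs)"
proof -
  have "(\<Sum>v\<in>V. s v * (r * c (v # xs))) = r * (\<Sum>v\<in>V. s v * c (v # xs))" for xs
    by (simp add: sum_distrib_left mult_ac)
  moreover have "swap_alt (\<lambda>xs. r * c xs)"
  proof -
    have "r * c (as @ y # x # bs) = - (r * c (as @ x # y # bs))" for as x y bs
      using assms swap_altD[of c as y x bs] by (simp add: harmonic_def)
    then show ?thesis unfolding swap_alt_def by blast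
  qed
  ultimately show ?thesis
    using assms by (auto simp: harmonic_def coboundary_scale)
qed

text \<open>The quadratic form of the derivation at \<open>c\<close> is at least \<open>?W\<close>
  times the squared norm, and it is also the eigenvalue-weighted sum of the squared coordinates.
  Since coordinates with eigenvalue at least \<open>?W\<close> vanish, all the others must vanish
  too.\<close>

lemma harmonic_eq_0:
  fixes n :: nat
  assumes G: "simple_graph V E" and h: "harmonic V E s m c"
    and Q: "\<And>u v. u \<in> V \<Longrightarrow> v \<in> V \<Longrightarrow> (\<Sum>i\<in>{1..n}. Q u i * Q v i) = (if u = v then 1 else 0)"
    and l: "\<And>u v. u \<in> V \<Longrightarrow> v \<in> V \<Longrightarrow> (\<Sum>i\<in>{1..n}. l i * Q u i * Q v i) = symmetric_laplacian E s u v"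
    and zero: "\<And>I. I \<subseteq> {1..n} \<Longrightarrow> card I = m \<Longrightarrow> (\<Sum>v\<in>V. (s v)\<^sup>2) \<le> (\<Sum>i\<in>I. l i) \<Longrightarrow>
        tensor_transform V Q c (sorted_list_of_set I) = 0"
  shows "(\<Sum>xs\<in>words V m. (c xs)\<^sup>2) = 0"
proof -
  have V: "finite V" using G by (simp add: simple_graph_def)
  have alt: "swap_alt c" and supp: "\<And>xs. c xs \<noteq> 0 \<Longrightarrow> length xs = m \<and> set xs \<in> independence_complex V E"
    and cyc: "\<And>xs. (\<Sum>v\<in>V. s v * c (v # xs)) = 0"
    and cocyc: "\<And>zs. set zs \<in> independence_complex V E \<Longrightarrow> length zs = Suc m \<Longrightarrow> coboundary s c zs = 0"
    using h unfolding harmonic_def by blast+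
  let ?W = "\<Sum>v\<in>V. (s v)\<^sup>2" and ?t = "tensor_transform V Q c"
  have parseval: "(\<Sum>is\<in>words {1..n} m. ?t is * ?t is) = (\<Sum>xs\<in>words V m. c xs * c xs)"
    by (rule tensor_parseval[OF V Q])
  have deriv: "(\<Sum>is\<in>words {1..n} m. sum_list (map l is) * (?t is * ?t is)) =
      (\<Sum>xs\<in>words V m. c xs * tensor_derivation V (symmetric_laplacian E s) c xs)"
    by (rule tensor_derivation_diagonal[OF V Q l])
  have low: "?W * (\<Sum>xs\<in>words V m. c xs * c xs) \<le>
      (\<Sum>xs\<in>words V m. c xs * tensor_derivation V (symmetric_laplacian E s) c xs)"
    unfolding sum_distrib_left
  proof (rule sum_mono)
    fix xs assume "xs \<in> words V m"
    show "?W * (c xs * c xs) \<le> c xs * tensor_derivation V (symmetric_laplacian E s) c xs"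
    proof (cases "c xs = 0")
      case False
      then have "set xs \<in> independence_complex V E" "length xs = m" using supp by auto
      then have "?W * (c xs)\<^sup>2 \<le> c xs * tensor_derivation V (symmetric_laplacian E s) c xs"
        using supp by (intro harmonic_derivation_bound[OF G alt, where m = m] cyc cocyc) auto
      then show ?thesis by (simp only: power2_eq_square)
    qed simp
  qed
  \<comment> \<open>Alternation reduces words to index sets: repeated indices give zero, and
    reordering changes only the sign.\<close>
  have good: "?t is = 0" if "is \<in> words {1..n} m" "?W \<le> sum_list (map l is) \<or> \<not> distinct is" for "is"
  proof (cases "distinct is")
    case False
    then show ?thesis by (intro swap_alt_not_distinct tensor_transform_swap_alt alt)
  next
    case True
    have "set is \<subseteq> {1..n}" "card (set is) = m"
      using that(1) True by (auto simp: words_def distinct_card)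
    moreover have "?W \<le> (\<Sum>i\<in>set is. l i)"
      using that(2) True by (simp add: sum_list_distinct_conv_sum_set)
    ultimately have "?t (sorted_list_of_set (set is)) = 0" by (rule zero)
    moreover have "mset (sorted_list_of_set (set is)) = mset is"
      using True by (simp add: set_eq_iff_mset_eq_distinct[symmetric])
    ultimately show ?thesis
      using swap_alt_mset[OF tensor_transform_swap_alt[OF alt]] by (metis abs_eq_0)
  qed
  have nonneg: "0 \<le> (?W - sum_list (map l is)) * (?t is * ?t is)" if "is \<in> words {1..n} m" for "is"
    using good[OF that] by (cases "?W \<le> sum_list (map l is)") auto
  have "(\<Sum>is\<in>words {1..n} m. (?W - sum_list (map l is)) * (?t is * ?t is)) \<le> 0"
    using low unfolding left_diff_distrib sum_subtractf sum_distrib_left[symmetric] parseval deriv by simp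
  then have "(\<Sum>is\<in>words {1..n} m. (?W - sum_list (map l is)) * (?t is * ?t is)) = 0"
    by (rule antisym) (rule sum_nonneg, rule nonneg)
  then have "\<forall>is\<in>words {1..n} m. (?W - sum_list (map l is)) * (?t is * ?t is) = 0"
    using nonneg by (subst (asm) sum_nonneg_eq_0_iff) (auto simp: finite_words)
  then have "?t is = 0" if "is \<in> words {1..n} m" for "is"
    using good[OF that] that by fastforce
  then show ?thesis using parseval by (simp add: power2_eq_square)
qed

section \<open>Homology and harmonic chains\<close>

lemma fun_subspace_oriented_chains: "fun_subspace (carrier (oriented_chains X m))"
proof -
  interpret C: vectorspace class_ring "oriented_chains X m" by (rule oriented_chains_vectorspace)
  have ops: "add (oriented_chains X m) = (\<lambda>c d xs. c xs + d xs)" "\<zero>\<^bsub>oriented_chains X m\<^esub> = (\<lambda>xs. 0)"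
    "module.smult (oriented_chains X m) = (\<lambda>r c xs. r * c xs)"
    by (simp_all add: oriented_chains_def)
  show ?thesis
    using C.M.add.m_closed C.smult_closed C.M.zero_closed
    unfolding fun_subspace_def ops by simp
qed

lemma boundary_add: "boundary X (\<lambda>xs. c xs + d xs) = (\<lambda>xs. boundary X c xs + boundary X d xs)"
  by (simp add: boundary_def fun_eq_iff sum.distrib)

lemma boundary_scale: "boundary X (\<lambda>xs. r * c xs) = (\<lambda>xs. r * boundary X c xs)"
  by (simp add: boundary_def fun_eq_iff sum_distrib_left)

lemma boundary_0: "boundary X (\<lambda>xs. 0) = (\<lambda>xs. 0)"
  by (simp add: boundary_def fun_eq_iff)

lemma fun_subspace_cycles: "fun_subspace (cycles X k)"
  using fun_subspace_oriented_chains[of X "k + 1"]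
  by (auto simp: fun_subspace_def cycles_def boundary_add boundary_scale boundary_0)

lemma fun_subspace_boundaries: "fun_subspace (boundaries X k)"
  using fun_subspace_oriented_chains[of X "k + 2"]
  unfolding fun_subspace_def boundaries_def
  by (auto simp: boundary_add[symmetric] boundary_scale[symmetric] simp del: add_2_eq_Suc'
      intro!: image_eqI[of _ "boundary X" "\<lambda>xs. 0"] boundary_0[symmetric])

lemma boundaries_subset_cycles:
  assumes "\<And>S T. S \<in> X \<Longrightarrow> T \<subseteq> S \<Longrightarrow> T \<in> X"
  shows "boundaries X k \<subseteq> cycles X k"
  using boundary_in_chains[OF assms, where m = "k + 1"] boundary_boundary
  by (fastforce simp: boundaries_def cycles_def)

text \<open>The classes of the \<open>z i\<close> generate the quotient. This carries the elementary
  notion of spanning over to the dimension of the module record.\<close>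

lemma reduced_homology_dim_le:
  assumes X: "\<And>S T. S \<in> X \<Longrightarrow> T \<subseteq> S \<Longrightarrow> T \<in> X"
    and span: "spans_mod (cycles X k) (boundaries X k) m z"
  shows "vectorspace.dim class_ring (reduced_homology X k) \<le> m"
proof -
  let ?H = "reduced_homology X k" and ?B = "boundaries X k" and ?Z = "cycles X k"
  interpret H: vectorspace class_ring ?H using X by (rule reduced_homology_vectorspace)
  have B0: "(\<lambda>x. 0) \<in> ?B" and Badd: "\<And>b c. b \<in> ?B \<Longrightarrow> c \<in> ?B \<Longrightarrow> (\<lambda>x. b x + c x) \<in> ?B"
    and Bsc: "\<And>b r. b \<in> ?B \<Longrightarrow> (\<lambda>x. r * b x) \<in> ?B"
    using fun_subspace_boundaries[of X k] by (simp_all add: fun_subspace_def)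
  \<comment> \<open>The coset of \<open>c\<close>; all operations of the quotient are first
    expressed through \<open>q\<close> and pointwise operations.\<close>
  define q where "q c = {(\<lambda>x. b x + c x) | b. b \<in> ?B}" for c
  have qI: "(\<lambda>x. b x + c x) \<in> q c" if "b \<in> ?B" for b c using that by (auto simp: q_def)
  have q_self: "c \<in> q c" for c using qI[OF B0, of c] by simp
  have carr: "carrier ?H = q ` ?Z"
    by (auto simp: reduced_homology_def quotient_module_def A_RCOSETS_def' a_r_coset_def'
        oriented_chains_def q_def)
  have absorb: "q (\<lambda>x. b x + c x) = q c" if b: "b \<in> ?B" for b c
  proof
    show "q (\<lambda>x. b x + c x) \<subseteq> q c"
    proof
      fix y assume "y \<in> q (\<lambda>x. b x + c x)"
      then obtain a where "a \<in> ?B" "y = (\<lambda>x. (a x + b x) + c x)" by (auto simp: q_def add.assoc)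
      with b show "y \<in> q c" using Badd by (auto simp: q_def)
    qed
    show "q c \<subseteq> q (\<lambda>x. b x + c x)"
    proof
      fix y assume "y \<in> q c"
      then obtain a where a: "a \<in> ?B" "y = (\<lambda>x. (a x + (-1) * b x) + (b x + c x))" by (auto simp: q_def)
      have "(\<lambda>x. a x + (-1) * b x) \<in> ?B" by (rule Badd[OF a(1) Bsc[OF b]])
      then show "y \<in> q (\<lambda>x. b x + c x)"
        unfolding q_def mem_Collect_eq a(2)
        by (intro exI[of _ "\<lambda>x. a x + (-1) * b x"] conjI refl)
    qed
  qed
  have qadd: "q c \<oplus>\<^bsub>?H\<^esub> q d = q (\<lambda>x. c x + d x)" for c d
  proof -
    have "q c \<oplus>\<^bsub>?H\<^esub> q d = {(\<lambda>x. u x + v x) | u v. u \<in> q c \<and> v \<in> q d}"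
      by (auto simp: reduced_homology_def quotient_module_def set_add_def' oriented_chains_def)
    also have "\<dots> = q (\<lambda>x. c x + d x)"
    proof
      show "{(\<lambda>x. u x + v x) | u v. u \<in> q c \<and> v \<in> q d} \<subseteq> q (\<lambda>x. c x + d x)"
      proof
        fix y assume "y \<in> {(\<lambda>x. u x + v x) | u v. u \<in> q c \<and> v \<in> q d}"
        then obtain a b where "a \<in> ?B" "b \<in> ?B" "y = (\<lambda>x. (a x + b x) + (c x + d x))"
          by (auto simp: q_def algebra_simps)
        then show "y \<in> q (\<lambda>x. c x + d x)" using Badd[of a b] by (auto simp: q_def)
      qed
      show "q (\<lambda>x. c x + d x) \<subseteq> {(\<lambda>x. u x + v x) | u v. u \<in> q c \<and> v \<in> q d}"
      proof
        fix y assume "y \<in> q (\<lambda>x. c x + d x)"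
        then obtain b where b: "b \<in> ?B" and y: "y = (\<lambda>x. (b x + c x) + d x)"
          by (auto simp: q_def add.assoc)
        show "y \<in> {(\<lambda>x. u x + v x) | u v. u \<in> q c \<and> v \<in> q d}"
          unfolding mem_Collect_eq y
          by (rule exI[of _ "\<lambda>x. b x + c x"], rule exI[of _ d]) (simp add: qI[OF b] q_self)
      qed
    qed
    finally show ?thesis .
  qed
  have qsmult: "r \<odot>\<^bsub>?H\<^esub> q c = q (\<lambda>x. r * c x)" for r c
  proof -
    have "r \<odot>\<^bsub>?H\<^esub> q c = (\<Union>y\<in>q c. q (\<lambda>x. r * y x))"
      by (auto simp: reduced_homology_def quotient_module_def a_r_coset_def' oriented_chains_def q_def)
    also have "\<dots> = (\<Union>y\<in>q c. q (\<lambda>x. r * c x))"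
    proof (rule SUP_cong[OF refl])
      fix y assume y: "y \<in> q c"
      from y obtain b where b: "b \<in> ?B" "y = (\<lambda>x. b x + c x)" by (auto simp: q_def)
      show "q (\<lambda>x. r * y x) = q (\<lambda>x. r * c x)"
        unfolding b(2) distrib_left by (rule absorb[OF Bsc[OF b(1)]])
    qed
    also have "\<dots> = q (\<lambda>x. r * c x)" using q_self[of c] by (intro UN_constant_eq) auto
    finally show ?thesis .
  qed
  have q0: "\<zero>\<^bsub>?H\<^esub> = q (\<lambda>x. 0)"
    by (simp add: reduced_homology_def quotient_module_def q_def)
  let ?A = "(\<lambda>i. q (z i)) ` {..<m}"
  have zZ: "z i \<in> ?Z" if "i < m" for i using span that by (simp add: spans_mod_def)
  have A: "?A \<subseteq> carrier ?H" using zZ carr by auto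
  have sub: "submodule class_ring (H.span ?A) ?H" using H.span_is_submodule[OF A] .
  have part: "q (\<lambda>x. \<Sum>i<j. a i * z i x) \<in> H.span ?A" if "j \<le> m" for j a
    using that
  proof (induction j)
    case 0
    show ?case using submodule.zero_closed[OF sub] q0 by simp
  next
    case (Suc j)
    have "q (z j) \<in> H.span ?A" using H.in_own_span[OF A] Suc.prems by auto
    then have "a j \<odot>\<^bsub>?H\<^esub> q (z j) \<in> H.span ?A"
      using submodule.smult_closed[OF sub, of "a j"] by simp
    then have "q (\<lambda>x. \<Sum>i<j. a i * z i x) \<oplus>\<^bsub>?H\<^esub> (a j \<odot>\<^bsub>?H\<^esub> q (z j)) \<in> H.span ?A"
      using submodule.m_closed[OF sub] Suc by simp
    then show ?case by (simp add: qadd qsmult)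
  qed
  have "carrier ?H \<subseteq> H.span ?A"
  proof
    fix y assume "y \<in> carrier ?H"
    then obtain c where c: "c \<in> ?Z" "y = q c" using carr by auto
    obtain a where a: "(\<lambda>x. c x - (\<Sum>i<m. a i * z i x)) \<in> ?B"
      using span c(1) by (auto simp: spans_mod_def)
    from absorb[OF a, of "\<lambda>x. \<Sum>i<m. a i * z i x"] c(2) part[of m a] show "y \<in> H.span ?A" by simp
  qed
  then have "H.gen_set ?A" using H.span_is_subset2[OF A] by auto
  then have "H.dim \<le> card ?A" using H.gen_ge_dim[OF _ A] by simp
  also have "\<dots> \<le> m" using card_image_le[of "{..<m}" "\<lambda>i. q (z i)"] by simp
  finally show ?thesis .
qed

section \<open>From homology of the independence complex to harmonic chains\<close>

lemma independence_complex_subset: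
  "S \<in> independence_complex V E \<Longrightarrow> T \<subseteq> S \<Longrightarrow> T \<in> independence_complex V E"
  by (auto simp: independence_complex_def)

text \<open>There are no loops, so single vertices are simplices and \<open>boundary\<close> sums
  over all of \<open>V\<close>.\<close>

lemma Union_independence_complex:
  assumes "simple_graph V E"
  shows "\<Union> (independence_complex V E) = V"
proof -
  have "{v} \<in> independence_complex V E" if "v \<in> V" for v
  proof -
    have "{v} \<notin> E" using assms unfolding simple_graph_def by (metis One_nat_def card_1_singleton_iff n_not_Suc_n numeral_2_eq_2)
    then show ?thesis using that by (simp add: independence_complex_def)
  qed
  then have "V \<subseteq> \<Union> (independence_complex V E)" by blast
  then show ?thesis by (auto simp: independence_complex_def)
qed

lemma swap_alt_weight:
  assumes "swap_alt c"
  shows "swap_alt (\<lambda>xs. c xs * prod_list (map s xs))" "swap_alt (\<lambda>xs. c xs / prod_list (map s xs))"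
proof -
  have "c (as @ y # x # bs) * prod_list (map s (as @ y # x # bs)) = - (c (as @ x # y # bs) * prod_list (map s (as @ x # y # bs)))"
    "c (as @ y # x # bs) / prod_list (map s (as @ y # x # bs)) = - (c (as @ x # y # bs) / prod_list (map s (as @ x # y # bs)))" for as x y bs
    using swap_altD[OF assms, of as y x bs] by (simp_all add: mult_ac)
  then show "swap_alt (\<lambda>xs. c xs * prod_list (map s xs))" "swap_alt (\<lambda>xs. c xs / prod_list (map s xs))"
    unfolding swap_alt_def by blast+
qed

text \<open>A Hodge argument: a cycle orthogonal to all boundaries is also a cocycle, for an inner
  product adapted to the weights. The excess dimension leaves room for the conditions from
  \<open>J\<close>.\<close>

lemma harmonic_cycle_exists:
  fixes k :: nat
  assumes G: "simple_graph V E" and s: "\<And>v. v \<in> V \<Longrightarrow> s v \<noteq> 0"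
    and J: "finite J" "\<And>js. js \<in> J \<Longrightarrow> length js = k + 1"
    and dim: "card J < vectorspace.dim class_ring (reduced_homology (independence_complex V E) k)"
  shows "\<exists>c. harmonic V E s (k + 1) c \<and> (\<forall>js\<in>J. tensor_transform V Q c js = 0) \<and>
    (\<Sum>xs\<in>words V (k + 1). (c xs)\<^sup>2) = 1"
proof -
  let ?X = "independence_complex V E" and ?m = "k + 1"
  let ?\<Omega> = "words V ?m"
  have V: "finite V" using G by (simp add: simple_graph_def)
  have \<Omega>: "finite ?\<Omega>" using V by (rule finite_words)
  have UX: "\<Union> ?X = V" using G by (rule Union_independence_complex)
  have XV: "S \<subseteq> V" if "S \<in> ?X" for S using that by (simp add: independence_complex_def)
  define p where "p xs = prod_list (map s xs)" for xs
  have p0: "p xs \<noteq> 0" if "set xs \<subseteq> V" for xs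
    using that s by (induction xs) (auto simp: p_def)
  have chain_supp: "length xs = j \<and> set xs \<in> ?X" if "c \<in> carrier (oriented_chains ?X j)" "c xs \<noteq> 0" for c j xs
    using that by (simp add: oriented_chains_def)
  \<comment> \<open>After division of the chains by \<open>p\<close>, the first sums are the
    coordinates at \<open>js\<close>, and the weight \<open>1 / (p xs)^2\<close> gives the standard
    inner product.\<close>
  have "\<exists>c\<in>cycles ?X k. c \<noteq> (\<lambda>x. 0) \<and>
      (\<forall>js\<in>J. (\<Sum>xs\<in>?\<Omega>. prod_list (map2 Q xs js) / p xs * c xs) = 0) \<and>
      (\<forall>b\<in>boundaries ?X k. (\<Sum>xs\<in>?\<Omega>. 1 / (p xs)\<^sup>2 * c xs * b xs) = 0)"
  proof (rule orthogonal_representative)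
    show "boundaries ?X k \<subseteq> cycles ?X k"
      by (rule boundaries_subset_cycles) (rule independence_complex_subset)
    show "c xs = 0" if "c \<in> cycles ?X k" "xs \<notin> ?\<Omega>" for c xs
      using that chain_supp[of c ?m xs] XV by (auto simp: cycles_def words_def)
    show "\<not> spans_mod (cycles ?X k) (boundaries ?X k) j z" if "j \<le> card J" for j z
      using reduced_homology_dim_le[of ?X k j z] independence_complex_subset[of _ V E] that dim by fastforce
  qed (rule fun_subspace_cycles fun_subspace_boundaries \<Omega> J(1))+
  then obtain c' where c': "c' \<in> cycles ?X k" "c' \<noteq> (\<lambda>x. 0)"
      "\<And>js. js \<in> J \<Longrightarrow> (\<Sum>xs\<in>?\<Omega>. prod_list (map2 Q xs js) / p xs * c' xs) = 0"
      "\<And>b. b \<in> boundaries ?X k \<Longrightarrow> (\<Sum>xs\<in>?\<Omega>. 1 / (p xs)\<^sup>2 * c' xs * b xs) = 0" by blast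
  have c'_chain: "c' \<in> carrier (oriented_chains ?X ?m)" and c'_cyc: "(\<Sum>v\<in>V. c' (v # xs)) = 0" for xs
    using c'(1) by (auto simp: cycles_def boundary_def UX dest: fun_cong)
  \<comment> \<open>Division by \<open>p\<close> turns the boundary operator into the one weighted by \<open>s\<close>.\<close>
  define c where "c xs = c' xs / p xs" for xs
  have alt: "swap_alt c"
    using swap_alt_weight(2)[OF oriented_chain_swap_alt[OF c'_chain], of s] by (simp add: c_def[abs_def] p_def)
  have supp: "length xs = ?m \<and> set xs \<in> ?X" if "c xs \<noteq> 0" for xs
    using chain_supp[OF c'_chain, of xs] that by (auto simp: c_def)
  have "(\<Sum>v\<in>V. s v * c (v # xs)) = 0" for xs
  proof -
    have "(\<Sum>v\<in>V. s v * c (v # xs)) = (\<Sum>v\<in>V. c' (v # xs) / p xs)"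
      by (rule sum.cong[OF refl]) (use s in \<open>simp add: c_def p_def\<close>)
    then show ?thesis using c'_cyc by (simp add: sum_divide_distrib[symmetric])
  qed
  moreover have "coboundary s c zs = 0" if zs: "set zs \<in> ?X" "length zs = Suc ?m" for zs
  proof -
    \<comment> \<open>The coboundary of \<open>c\<close>, cut off outside the complex, serves as its
      own test chain: by adjointness and orthogonality its squared norm is zero.\<close>
    define d where "d zs = (if length zs = Suc ?m \<and> set zs \<in> ?X then coboundary s c zs else 0)" for zs
    have d_alt: "swap_alt d"
    proof -
      have "d (as @ y # x # bs) = - d (as @ x # y # bs)" for as x y bs
        using swap_altD[OF coboundary_swap_alt[OF alt], of s as y x bs]
        by (simp add: d_def insert_commute)
      then show ?thesis unfolding swap_alt_def by blast
    qed
    have "(\<lambda>zs. d zs * p zs) \<in> carrier (oriented_chains ?X (k + 2))"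
      by (rule oriented_chainI)
         (use swap_alt_weight(1)[OF d_alt, of s] in \<open>auto simp: p_def d_def split: if_splits\<close>)
    then have b: "boundary ?X (\<lambda>zs. d zs * p zs) \<in> boundaries ?X k" by (simp add: boundaries_def)
    have "(\<Sum>xs\<in>?\<Omega>. c xs * (\<Sum>v\<in>V. s v * d (v # xs))) =
        (\<Sum>xs\<in>?\<Omega>. 1 / (p xs)\<^sup>2 * c' xs * boundary ?X (\<lambda>zs. d zs * p zs) xs)"
    proof (rule sum.cong[OF refl])
      fix xs assume "xs \<in> ?\<Omega>"
      then have "p xs \<noteq> 0" by (intro p0) (simp add: words_def)
      moreover have "boundary ?X (\<lambda>zs. d zs * p zs) xs = p xs * (\<Sum>v\<in>V. s v * d (v # xs))"
        by (simp add: boundary_def UX p_def sum_distrib_left mult_ac)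
      ultimately show "c xs * (\<Sum>v\<in>V. s v * d (v # xs)) =
          1 / (p xs)\<^sup>2 * c' xs * boundary ?X (\<lambda>zs. d zs * p zs) xs"
        by (simp add: c_def power2_eq_square)
    qed
    also have "\<dots> = 0" by (rule c'(4)[OF b])
    finally have "(\<Sum>zs\<in>words V (Suc ?m). coboundary s c zs * d zs) = 0"
      unfolding coboundary_adjoint[OF d_alt] by simp
    moreover have "coboundary s c zs * d zs = (d zs)\<^sup>2" for zs
      by (simp add: d_def power2_eq_square)
    ultimately have "\<forall>zs\<in>words V (Suc ?m). (d zs)\<^sup>2 = 0"
      using sum_nonneg_eq_0_iff[OF finite_words[OF V], of "Suc ?m" "\<lambda>zs. (d zs)\<^sup>2"] by simp
    then have "d zs = 0" using zs XV by (auto simp: words_def)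
    then show ?thesis using zs by (simp add: d_def)
  qed
  ultimately have harm: "harmonic V E s ?m c"
    using alt supp unfolding harmonic_def by blast
  have transf: "tensor_transform V Q (\<lambda>xs. r * c xs) js = 0" if "js \<in> J" for js r
  proof -
    have "tensor_transform V Q (\<lambda>xs. r * c xs) js = (\<Sum>xs\<in>?\<Omega>. r * (prod_list (map2 Q xs js) / p xs * c' xs))"
      unfolding tensor_transform_conv_sum J(2)[OF that]
      by (intro sum.cong refl) (simp add: c_def mult_ac)
    then show ?thesis unfolding sum_distrib_left[symmetric] c'(3)[OF that] by simp
  qed
  let ?N = "\<Sum>xs\<in>?\<Omega>. (c xs)\<^sup>2"
  obtain xs where "c' xs \<noteq> 0" using c'(2) by auto
  moreover from this have "xs \<in> ?\<Omega>" using chain_supp[OF c'_chain, of xs] XV by (auto simp: words_def)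
  moreover from this have "p xs \<noteq> 0" by (intro p0) (simp add: words_def)
  ultimately have "?N \<noteq> 0"
    using sum_nonneg_eq_0_iff[OF \<Omega>, of "\<lambda>xs. (c xs)\<^sup>2"] by (auto simp: c_def)
  then have N: "?N > 0" using sum_nonneg[of ?\<Omega> "\<lambda>xs. (c xs)\<^sup>2"] by simp
  have "(\<Sum>xs\<in>?\<Omega>. (1 / sqrt ?N * c xs)\<^sup>2) = 1 / ?N * ?N"
    unfolding power_mult_distrib sum_distrib_left[symmetric] using N by (simp add: power_divide)
  then show ?thesis
    using harmonic_scale[OF harm, of "1 / sqrt ?N"] transf[of _ "1 / sqrt ?N"] N
    by (intro exI[of _ "\<lambda>xs. 1 / sqrt ?N * c xs"]) simp
qed

section \<open>Passage to the limit of the weights\<close>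

lemma tendsto_coboundary:
  assumes "\<And>v. (\<lambda>j. s j v) \<longlonglongrightarrow> t v" "\<And>xs. (\<lambda>j. f j xs) \<longlonglongrightarrow> c xs"
  shows "(\<lambda>j. coboundary (s j) (f j) xs) \<longlonglongrightarrow> coboundary t c xs"
  using assms(2) by (induction xs arbitrary: f c) (auto intro!: tendsto_intros assms(1))

text \<open>Each condition concerns only finitely many values of the chain and depends on them and
  on the weights continuously.\<close>

lemma harmonic_limit:
  assumes s: "\<And>v. (\<lambda>j. s j v) \<longlonglongrightarrow> t v" and f: "\<And>xs. (\<lambda>j. f j xs) \<longlonglongrightarrow> c xs"
    and h: "\<And>j. harmonic V E (s j) m (f j)"
  shows "harmonic V E t m c"
proof -
  have "c (as @ y # x # bs) = - c (as @ x # y # bs)" for as x y bs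
  proof (rule LIMSEQ_unique[OF f])
    have "f j (as @ y # x # bs) = - f j (as @ x # y # bs)" for j
      using h[of j] swap_altD[of "f j" as y x bs] by (simp add: harmonic_def)
    then show "(\<lambda>j. f j (as @ y # x # bs)) \<longlonglongrightarrow> - c (as @ x # y # bs)"
      using tendsto_minus[OF f[of "as @ x # y # bs"]] by simp
  qed
  moreover have "c xs = 0" if "\<not> (length xs = m \<and> set xs \<in> independence_complex V E)" for xs
  proof (rule LIMSEQ_unique[OF f])
    have "f j xs = 0" for j using h[of j] that by (auto simp: harmonic_def)
    then show "(\<lambda>j. f j xs) \<longlonglongrightarrow> 0" by simp
  qed
  moreover have "(\<Sum>v\<in>V. t v * c (v # xs)) = 0" for xs
  proof (rule LIMSEQ_unique)
    show "(\<lambda>j. \<Sum>v\<in>V. s j v * f j (v # xs)) \<longlonglongrightarrow> (\<Sum>v\<in>V. t v * c (v # xs))"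
      by (intro tendsto_intros s f)
    show "(\<lambda>j. \<Sum>v\<in>V. s j v * f j (v # xs)) \<longlonglongrightarrow> 0" using h by (simp add: harmonic_def)
  qed
  moreover have "coboundary t c zs = 0"
    if "set zs \<in> independence_complex V E" "length zs = Suc m" for zs
  proof (rule LIMSEQ_unique[OF tendsto_coboundary[OF s f]])
    show "(\<lambda>j. coboundary (s j) (f j) zs) \<longlonglongrightarrow> 0" using h that by (simp add: harmonic_def)
  qed
  ultimately show ?thesis unfolding harmonic_def swap_alt_def by blast
qed

theorem theorem1p4:
  fixes V :: "'a set" and E :: "'a set set" and w :: "'a \<Rightarrow> real"
    and n :: nat and vs :: "'a list" and l :: "nat \<Rightarrow> real" and k :: nat
  assumes "simple_graph V E" and "card V = n"
    and "\<And>v. v \<in> V \<Longrightarrow> w v \<ge> 0"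
    and "distinct vs" and "set vs = V"
    and "ordered_eigenvalues (matrix_wrt vs (weighted_laplacian E w)) l"
  shows "vectorspace.dim class_ring (reduced_homology (independence_complex V E) k)
         \<le> card {I. I \<subseteq> {1..n} \<and> card I = k + 1 \<and> (\<Sum>i\<in>I. l i) \<ge> (\<Sum>v\<in>V. w v)}"
proof (rule ccontr)
  let ?good = "{I. I \<subseteq> {1..n} \<and> card I = k + 1 \<and> (\<Sum>i\<in>I. l i) \<ge> (\<Sum>v\<in>V. w v)}"
  let ?\<Omega> = "words V (k + 1)"
  assume "\<not> ?thesis"
  then have dim: "card ?good < vectorspace.dim class_ring (reduced_homology (independence_complex V E) k)"
    by simp
  have V: "finite V" and n: "length vs = n"
    using assms(2,4,5) distinct_card[of vs] by auto
  have fin: "finite ?good" by (rule finite_subset[of _ "Pow {1..n}"]) auto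
  define J where "J = sorted_list_of_set ` ?good"
  have J: "finite J" "card J \<le> card ?good" "\<And>js. js \<in> J \<Longrightarrow> length js = k + 1"
    using fin by (auto simp: J_def card_image_le)
  define s where "s v = sqrt (w v)" for v
  have s2: "(s v)\<^sup>2 = w v" if "v \<in> V" for v using assms(3)[OF that] by (simp add: s_def)
  have "dim_row (matrix_wrt vs (weighted_laplacian E w)) = n" using n by (simp add: matrix_wrt_def)
  then have cp: "char_poly (matrix_wrt vs (symmetric_laplacian E s)) = (\<Prod>i=1..n. [:- l i, 1:])"
    using assms(6) char_poly_weighted_laplacian[OF assms(1,4,5) s2] by (simp add: ordered_eigenvalues_def)
  \<comment> \<open>The eigenbasis belongs to the limit weights \<open>s\<close>, not to their
    perturbations, so the same coordinates are required to vanish for every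
    \<open>j\<close>.\<close>
  obtain Q where Q: "\<And>u v. u \<in> V \<Longrightarrow> v \<in> V \<Longrightarrow> (\<Sum>i=1..n. Q u i * Q v i) = (if u = v then 1 else 0)"
    "\<And>u v. u \<in> V \<Longrightarrow> v \<in> V \<Longrightarrow> (\<Sum>i=1..n. l i * Q u i * Q v i) = symmetric_laplacian E s u v"
    using ordered_eigenvalues_orthonormal_eigenbasis[OF assms(4,5) n,
        of "symmetric_laplacian E s" l, OF symmetric_laplacian_sym cp] by (elim exE conjE) blast
  \<comment> \<open>Positive also at vertices of weight zero, so harmonic chains can be obtained
    from homology.\<close>
  define t where "t j v = s v + 1 / real (Suc j)" for j v
  have t0: "t j v \<noteq> 0" if "v \<in> V" for j v
  proof -
    have "0 \<le> s v" using assms(3)[OF that] by (simp add: s_def)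
    then have "0 < t j v" unfolding t_def by (intro add_nonneg_pos) simp_all
    then show ?thesis by simp
  qed
  have t_lim: "(\<lambda>j. t j v) \<longlonglongrightarrow> s v" for v
    unfolding t_def using tendsto_add[OF tendsto_const LIMSEQ_inverse_real_of_nat, of "s v"]
    by (simp add: inverse_eq_divide)
  have "\<forall>j. \<exists>c. harmonic V E (t j) (k + 1) c \<and> (\<forall>js\<in>J. tensor_transform V Q c js = 0) \<and>
      (\<Sum>xs\<in>?\<Omega>. (c xs)\<^sup>2) = 1"
    using J dim t0 by (intro allI harmonic_cycle_exists assms(1)) auto
  then obtain f where f: "\<And>j. harmonic V E (t j) (k + 1) (f j)"
    "\<And>j js. js \<in> J \<Longrightarrow> tensor_transform V Q (f j) js = 0" "\<And>j. (\<Sum>xs\<in>?\<Omega>. (f j xs)\<^sup>2) = 1" by metis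
  have \<Omega>: "finite ?\<Omega>" using V by (rule finite_words)
  have f_out: "f j xs = 0" if "xs \<notin> ?\<Omega>" for j xs
    using f(1)[of j] that by (auto simp: harmonic_def words_def independence_complex_def)
  have "\<bar>f j xs\<bar> \<le> 1" if "xs \<in> ?\<Omega>" for j xs
    using member_le_sum[OF that, of "\<lambda>xs. (f j xs)\<^sup>2"] f(3)[of j] \<Omega> by (simp add: abs_square_le_1)
  then obtain r c0 where r: "strict_mono (r :: nat \<Rightarrow> nat)" "\<forall>xs\<in>?\<Omega>. (\<lambda>j. f (r j) xs) \<longlonglongrightarrow> c0 xs"
    using bounded_functions_convergent_subsequence[OF \<Omega>, of f 1] by blast
  define c where "c xs = (if xs \<in> ?\<Omega> then c0 xs else 0)" for xs
  \<comment> \<open>All \<open>f j\<close> vanish outside the finite set \<open>?\<Omega>\<close>,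
    so convergence there is convergence everywhere.\<close>
  have lim: "(\<lambda>j. f (r j) xs) \<longlonglongrightarrow> c xs" for xs
    using r(2) f_out by (cases "xs \<in> ?\<Omega>") (auto simp: c_def)
  have "(\<lambda>j. t (r j) v) \<longlonglongrightarrow> s v" for v
    using LIMSEQ_subseq_LIMSEQ[OF t_lim r(1)] by (simp add: o_def)
  then have "harmonic V E s (k + 1) c"
    using lim f(1) by (rule harmonic_limit)
  moreover have "tensor_transform V Q c js = 0" if "js \<in> J" for js
  proof (rule LIMSEQ_unique)
    show "(\<lambda>j. tensor_transform V Q (f (r j)) js) \<longlonglongrightarrow> tensor_transform V Q c js"
      unfolding tensor_transform_conv_sum by (intro tendsto_intros lim)
    show "(\<lambda>j. tensor_transform V Q (f (r j)) js) \<longlonglongrightarrow> 0" using f(2)[OF that] by simp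
  qed
  moreover have "(\<Sum>v\<in>V. (s v)\<^sup>2) = (\<Sum>v\<in>V. w v)" using s2 by simp
  \<comment> \<open>Only for the limit chain do its weights match those of the diagonalized
    matrix.\<close>
  ultimately have "(\<Sum>xs\<in>?\<Omega>. (c xs)\<^sup>2) = 0"
    by (intro harmonic_eq_0[OF assms(1) _ Q]) (auto simp: J_def)
  moreover have "(\<Sum>xs\<in>?\<Omega>. (c xs)\<^sup>2) = 1"
  proof (rule LIMSEQ_unique)
    show "(\<lambda>j. \<Sum>xs\<in>?\<Omega>. (f (r j) xs)\<^sup>2) \<longlonglongrightarrow> (\<Sum>xs\<in>?\<Omega>. (c xs)\<^sup>2)"
      by (intro tendsto_intros lim)
    show "(\<lambda>j. \<Sum>xs\<in>?\<Omega>. (f (r j) xs)\<^sup>2) \<longlonglongrightarrow> 1" unfolding f(3) by simp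
  qed
  ultimately show False by simp
qed

end
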